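(* Let $X$ be a separable infinite-dimensional Fréchet algebra over $\mathbb{K}\in\{\mathbb{R},\mathbb{C}\}$ that admits a continuous norm. Let $\mathcal{A}$ be a dense countable-dimensional subalgebra of $X$ and let $a\in\mathcal{A}\setminus\{0\}$. Then there exists a continuous linear operator $T:X\to X$ of the form $T=I+K$, where $I$ is the identity and $K:X\to X$ is a nuclear operator, such that $\mathcal{A}=\operatorname{span}\,\mathrm{Orb}(a,T)$. In particular, $\mathcal{A}$ is a $T$-invariant hypercyclic algebra for $T$, i.e. $T(\mathcal{A})\subset\mathcal{A}$ and every nonzero element of $\mathcal{A}$ is a hypercyclic vector for $T$.
   Context: All vector spaces are over $\mathbb{K}\in\{\mathbb{R},\mathbb{C}\}$ and Hausdorff; all dimensions are algebraic (Hamel) dimensions, and $\operatorname{span}$ is the (algebraic) linear span. A Fréchet space is a locally convex, complete metrizable topological vector space (equivalently, its topology is defined by a separating increasing sequence of seminorms for which it is complete). A Fréchet space $X$ admits a continuous norm if there is a norm $\|\cdot\|:X\to\mathbb{R}$ that is continuous for the topology of $X$. A Fréchet algebra is a Fréchet space equipped with a bilinear associative multiplication $X\times X\to X$ that is continuous for the product topology; it need not be commutative or unital. A subalgebra is a linear subspace closed under multiplication; it is not required to contain a unit. For a continuous linear operator $T:X\to X$ and $x\in X$, the orbit is $\mathrm{Orb}(x,T)=\{T^n x: n\ge 0\}$; $x$ is a hypercyclic vector for $T$ if $\mathrm{Orb}(x,T)$ is dense in $X$, and $HC(T)$ is the set of hypercyclic vectors. A nonzero subalgebra $\mathcal{A}\subset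 X$ is a hypercyclic algebra for $T$ if $\mathcal{A}\setminus\{0\}\subset HC(T)$. Nuclear operator has its standard meaning: $K:X\to X$ is nuclear if $Kx=\sum_{n}\lambda_n f_n(x)x_n$ for all $x\in X$, for some $(\lambda_n)_n\in\ell_1$, some equicontinuous sequence $(f_n)_n$ in the dual $X'$, and some bounded sequence $(x_n)_n$ in $X$. *)

theory Defs
  imports "HOL-Analysis.Analysis"
begin

text \<open>
  The scalar fields \<open>\<real>\<close> and \<open>\<complex>\<close>: normed fields isometrically isomorphic, over the reals,
  to one of the two subfields \<open>\<real>\<close> and \<open>UNIV\<close> of the complex numbers.
\<close>

class real_or_complex = real_normed_field +
  assumes ex_embedding: "\<exists>\<phi> :: 'a \<Rightarrow> complex.
      (\<forall>x y. \<phi> (x + y) = \<phi> x + \<phi> y) \<and>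
      (\<forall>x y. \<phi> (x * y) = \<phi> x * \<phi> y) \<and>
      (\<forall>r. \<phi> (scaleR r 1) = of_real r) \<and>
      (\<forall>x. norm (\<phi> x) = norm x) \<and>
      (range \<phi> = \<real> \<or> range \<phi> = UNIV)"

instance real :: real_or_complex
proof
  show "\<exists>\<phi> :: real \<Rightarrow> complex.
      (\<forall>x y. \<phi> (x + y) = \<phi> x + \<phi> y) \<and>
      (\<forall>x y. \<phi> (x * y) = \<phi> x * \<phi> y) \<and>
      (\<forall>r. \<phi> (scaleR r 1) = of_real r) \<and>
      (\<forall>x. norm (\<phi> x) = norm x) \<and>
      (range \<phi> = \<real> \<or> range \<phi> = UNIV)"
    by (rule exI[of _ complex_of_real]) (simp add: Reals_def)
qed

instance complex :: real_or_complex
proof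
  show "\<exists>\<phi> :: complex \<Rightarrow> complex.
      (\<forall>x y. \<phi> (x + y) = \<phi> x + \<phi> y) \<and>
      (\<forall>x y. \<phi> (x * y) = \<phi> x * \<phi> y) \<and>
      (\<forall>r. \<phi> (scaleR r 1) = of_real r) \<and>
      (\<forall>x. norm (\<phi> x) = norm x) \<and>
      (range \<phi> = \<real> \<or> range \<phi> = UNIV)"
    by (rule exI[of _ "\<lambda>z. z"]) (simp add: scaleR_conv_of_real)
qed

text \<open>
  Since the library's classes of topological vector spaces are over the reals only, the scalar
  multiplication is an explicit parameter, as in the locale \<^locale>\<open>vector_space\<close>; the remaining
  structure is carried by the type.
\<close>

definition seminorm :: "('k::real_normed_field \<Rightarrow> 'a::ab_group_add \<Rightarrow> 'a) \<Rightarrow> ('a \<Rightarrow> real) \<Rightarrow> bool" where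
  "seminorm smul p \<longleftrightarrow>
     (\<forall>x. 0 \<le> p x) \<and>
     (\<forall>c x. p (smul c x) = norm c * p x) \<and>
     (\<forall>x y. p (x + y) \<le> p x + p y)"

definition admits_continuous_norm ::
    "('k::real_normed_field \<Rightarrow> 'a::{ab_group_add,topological_space} \<Rightarrow> 'a) \<Rightarrow> bool" where
  "admits_continuous_norm smul \<longleftrightarrow>
     (\<exists>N. seminorm smul N \<and> (\<forall>x. N x = 0 \<longrightarrow> x = 0) \<and> continuous_on UNIV N)"

definition frechet_topology ::
    "('k::real_normed_field \<Rightarrow> 'a::{ab_group_add,topological_space} \<Rightarrow> 'a) \<Rightarrow> (nat \<Rightarrow> 'a \<Rightarrow> real) \<Rightarrow> bool"
  where
  "frechet_topology smul p \<longleftrightarrow>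
     (\<forall>n. seminorm smul (p n)) \<and>
     (\<forall>n x. p n x \<le> p (Suc n) x) \<and>
     (\<forall>x. x \<noteq> 0 \<longrightarrow> (\<exists>n. p n x \<noteq> 0)) \<and>
     (\<forall>U. open U \<longleftrightarrow> (\<forall>x\<in>U. \<exists>n. \<exists>e>0. {y. p n (y - x) < e} \<subseteq> U)) \<and>
     (\<forall>s. (\<forall>n. \<forall>e>0. \<exists>M. \<forall>i\<ge>M. \<forall>j\<ge>M. p n (s i - s j) < e) \<longrightarrow> (\<exists>l. s \<longlonglongrightarrow> l))"

locale frechet_space = vector_space smul
  for smul :: "'k::real_or_complex \<Rightarrow> 'a::{ab_group_add,topological_space} \<Rightarrow> 'a" +
  assumes ex_seminorms: "\<exists>p. frechet_topology smul p"

text \<open>The class \<^class>\<open>ring\<close> has neither a unit nor commutativity of the multiplication.\<close>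

locale frechet_algebra = frechet_space smul
  for smul :: "'k::real_or_complex \<Rightarrow> 'a::{ring,topological_space} \<Rightarrow> 'a" +
  assumes smul_mult_left: "smul c x * y = smul c (x * y)"
    and smul_mult_right: "x * smul c y = smul c (x * y)"
    and continuous_mult: "continuous_on UNIV (\<lambda>(x :: 'a, y). x * y)"

definition infinite_dimensional :: "('k::field \<Rightarrow> 'a::ab_group_add \<Rightarrow> 'a) \<Rightarrow> bool" where
  "infinite_dimensional smul \<longleftrightarrow> \<not> (\<exists>B. finite B \<and> module.span smul B = UNIV)"

definition countable_dimensional :: "('k::field \<Rightarrow> 'a::ab_group_add \<Rightarrow> 'a) \<Rightarrow> 'a set \<Rightarrow> bool" where
  "countable_dimensional smul A \<longleftrightarrow>
     (\<exists>B. countable B \<and> \<not> module.dependent smul B \<and> module.span smul B = A)"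

definition subalgebra :: "('k::field \<Rightarrow> 'a::ring \<Rightarrow> 'a) \<Rightarrow> 'a set \<Rightarrow> bool" where
  "subalgebra smul A \<longleftrightarrow> module.subspace smul A \<and> (\<forall>x\<in>A. \<forall>y\<in>A. x * y \<in> A)"

definition continuous_linear ::
    "('k::field \<Rightarrow> 'a::{ab_group_add,topological_space} \<Rightarrow> 'a) \<Rightarrow>
     ('k \<Rightarrow> 'b::{ab_group_add,topological_space} \<Rightarrow> 'b) \<Rightarrow> ('a \<Rightarrow> 'b) \<Rightarrow> bool" where
  "continuous_linear smul1 smul2 T \<longleftrightarrow>
     Vector_Spaces.linear smul1 smul2 T \<and> continuous_on UNIV T"

definition equicontinuous :: "(nat \<Rightarrow> 'a::topological_space \<Rightarrow> 'k::metric_space) \<Rightarrow> bool" where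
  "equicontinuous f \<longleftrightarrow>
     (\<forall>x. \<forall>e>0. \<exists>U. open U \<and> x \<in> U \<and> (\<forall>n. \<forall>y\<in>U. dist (f n y) (f n x) < e))"

text \<open>Boundedness in a topological vector space: every neighbourhood of 0 absorbs the set.\<close>

definition tvs_bounded ::
    "('k::real_normed_field \<Rightarrow> 'a::{ab_group_add,topological_space} \<Rightarrow> 'a) \<Rightarrow> 'a set \<Rightarrow> bool" where
  "tvs_bounded smul S \<longleftrightarrow>
     (\<forall>U. open U \<and> 0 \<in> U \<longrightarrow> (\<exists>r>0. \<forall>c. r \<le> norm c \<longrightarrow> S \<subseteq> smul c ` U))"

definition nuclear ::
    "('k::real_normed_field \<Rightarrow> 'a::{ab_group_add,topological_space} \<Rightarrow> 'a) \<Rightarrow> ('a \<Rightarrow> 'a) \<Rightarrow> bool" where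
  "nuclear smul K \<longleftrightarrow>
     (\<exists>(l :: nat \<Rightarrow> 'k) (f :: nat \<Rightarrow> 'a \<Rightarrow> 'k) (v :: nat \<Rightarrow> 'a).
        summable (\<lambda>n. norm (l n)) \<and>
        (\<forall>n. continuous_linear smul (*) (f n)) \<and> equicontinuous f \<and>
        tvs_bounded smul (range v) \<and>
        (\<forall>x. (\<lambda>n. smul (l n * f n x) (v n)) sums K x))"

definition orb :: "'a \<Rightarrow> ('a \<Rightarrow> 'a) \<Rightarrow> 'a set" where
  "orb x T = {(T ^^ n) x | n. True}"

definition HC :: "('a::topological_space \<Rightarrow> 'a) \<Rightarrow> 'a set" where
  "HC T = {x. closure (orb x T) = UNIV}"

definition hypercyclic_algebra ::
    "('k::field \<Rightarrow> 'a::{ring,topological_space} \<Rightarrow> 'a) \<Rightarrow> ('a \<Rightarrow> 'a) \<Rightarrow> 'a set \<Rightarrow> bool" where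
  "hypercyclic_algebra smul T A \<longleftrightarrow> subalgebra smul A \<and> A \<noteq> {0} \<and> A - {0} \<subseteq> HC T"

end

theory Submission
  imports Defs
begin

text \<open>
  A continuous norm makes it possible to separate points from finite-dimensional subspaces by
  functionals bounded by that norm, so that a rank-one series with small vectors is a
  nuclear operator that contracts the norm.

  A first hypercyclic operator \<open>I + K\<close> is modelled on the translation \<open>q(X) \<mapsto> q(X + 1)\<close> of
  polynomials: the monomials go to a suitably rescaled biorthogonal sequence with dense span.
  The polynomials \<open>X\<^sup>j (1 - X/m)\<^sup>j\<^sup>+\<^sup>1\<close> tend to \<open>X\<^sup>j\<close> while their translates by \<open>m\<close> tend to 0, and a
  similar sequence does the converse, which gives transitivity and, by Baire, a hypercyclic vector
  \<open>x\<close> as close to \<open>a\<close> as desired. On the span of the biorthogonal sequence \<open>K\<close> is onto and locally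
  nilpotent, hence nonzero polynomials in \<open>K\<close> have dense range and all nonzero vectors in the span
  of the orbit of \<open>x\<close> are hypercyclic.

  A back-and-forth construction yields an isomorphism \<open>J = I + L\<close> that maps \<open>x\<close> to \<open>a\<close> and the
  span of the orbit of \<open>x\<close> onto the given subalgebra; conjugation by \<open>J\<close> finishes the proof.
\<close>

section \<open>The Hahn--Banach theorem\<close>

definition sublinear :: "(real \<Rightarrow> 'a::ab_group_add \<Rightarrow> 'a) \<Rightarrow> ('a \<Rightarrow> real) \<Rightarrow> bool" where
  "sublinear s q \<longleftrightarrow>
     (\<forall>x y. q (x + y) \<le> q x + q y) \<and> (\<forall>t x. 0 \<le> t \<longrightarrow> q (s t x) = t * q x)"

lemma sublinear_zero:
  assumes "sublinear s q" "vector_space s"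
  shows "q 0 = 0"
proof -
  interpret s: vector_space s by fact
  show ?thesis
    using assms(1) unfolding sublinear_def by (metis mult_zero_left order_refl s.scale_zero_left)
qed

lemma sublinear_minus_le:
  assumes "sublinear s q" "vector_space s"
  shows "- q (- x) \<le> q x"
  using assms sublinear_zero[OF assms] unfolding sublinear_def
  by (smt (verit) add.right_inverse)

lemma sublinear_cone_inf:
  fixes y :: "'a::ab_group_add"
  assumes s: "vector_space s" and q: "sublinear s q"
  defines "r \<equiv> \<lambda>x. INF t\<in>{0..}. q (x + s t y) - t * q y"
  shows "sublinear s r" "\<And>x t. 0 \<le> t \<Longrightarrow> r x \<le> q (x + s t y) - t * q y"
proof -
  interpret s: vector_space s by fact
  have add: "q (u + v) \<le> q u + q v" and hom: "0 \<le> t \<Longrightarrow> q (s t u) = t * q u" for t u v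
    using q by (auto simp: sublinear_def)
  have lower: "- q (- x) \<le> q (x + s t y) - t * q y" if "0 \<le> t" for x t
    using add[of "x + s t y" "- x"] hom[OF that, of y] by simp
  have bdd: "bdd_below ((\<lambda>t. q (x + s t y) - t * q y) ` {0..})" for x
    using lower by (intro bdd_belowI[of _ "- q (- x)"]) auto
  show le: "r x \<le> q (x + s t y) - t * q y" if "0 \<le> t" for x t
    unfolding r_def using that by (intro cINF_lower bdd) auto
  have greatest: "z \<le> r x" if "\<And>t. 0 \<le> t \<Longrightarrow> z \<le> q (x + s t y) - t * q y" for x z
    unfolding r_def using that by (intro cINF_greatest) auto
  have radd: "r (u + v) \<le> r u + r v" for u v
  proof -
    have "r (u + v) - (q (v + s t' y) - t' * q y) \<le> q (u + s t y) - t * q y"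
      if "0 \<le> t" "0 \<le> t'" for t t'
    proof -
      have "r (u + v) \<le> q (u + v + s (t + t') y) - (t + t') * q y"
        using that by (intro le) simp
      also have "u + v + s (t + t') y = (u + s t y) + (v + s t' y)"
        by (simp add: s.scale_left_distrib)
      also have "q \<dots> \<le> q (u + s t y) + q (v + s t' y)"
        by (rule add)
      finally show ?thesis by (simp add: algebra_simps)
    qed
    then have "r (u + v) - r u \<le> q (v + s t' y) - t' * q y" if "0 \<le> t'" for t'
      using greatest[of "r (u + v) - (q (v + s t' y) - t' * q y)" u] that by force
    from greatest[OF this] show ?thesis by simp
  qed
  have rhom_le: "c * r u \<le> r (s c u)" if "0 < c" for c u
  proof (rule greatest)
    fix t :: real assume "0 \<le> t"
    then have "c * r u \<le> c * (q (u + s (t / c) y) - t / c * q y)"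
      using that le[of "t / c" u] by simp
    also have "\<dots> = q (s c (u + s (t / c) y)) - t * q y"
      using that hom[of c "u + s (t / c) y"] by (simp add: right_diff_distrib)
    also have "s c (u + s (t / c) y) = s c u + s t y"
      using that by (simp add: s.scale_right_distrib)
    finally show "c * r u \<le> q (s c u + s t y) - t * q y" .
  qed
  have r0: "r 0 = 0"
  proof (rule antisym)
    show "r 0 \<le> 0" using le[of 0 0] sublinear_zero[OF q s] by simp
    show "0 \<le> r 0" by (rule greatest) (use hom in auto)
  qed
  have "r (s c u) = c * r u" if "0 \<le> c" for c u
  proof (cases "c = 0")
    case False
    then have c: "0 < c" using that by simp
    have "inverse c * r (s c u) \<le> r u"
      using rhom_le[of "inverse c" "s c u"] c by simp
    then have "r (s c u) \<le> c * r u" using c by (simp add: field_simps)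
    then show ?thesis using rhom_le[OF c, of u] by simp
  qed (simp add: r0)
  then show "sublinear s r" using radd by (auto simp: sublinear_def)
qed

lemma sublinear_chain_inf:
  assumes s: "vector_space s" and ne: "C \<noteq> {}" and sub: "\<And>f. f \<in> C \<Longrightarrow> sublinear s f"
    and q: "\<And>f x. f \<in> C \<Longrightarrow> f x \<le> q x"
    and chain: "\<And>f g. f \<in> C \<Longrightarrow> g \<in> C \<Longrightarrow> f \<le> g \<or> g \<le> f"
  defines "r \<equiv> \<lambda>x. INF f\<in>C. f x"
  shows "sublinear s r" "\<And>f x. f \<in> C \<Longrightarrow> r x \<le> f x"
proof -
  have bdd: "bdd_below ((\<lambda>f. f x) ` C)" for x
  proof (rule bdd_belowI)
    fix z assume "z \<in> (\<lambda>f. f x) ` C"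
    then obtain f where f: "f \<in> C" "z = f x" by auto
    show "- q (- x) \<le> z"
      using sublinear_minus_le[OF sub[OF f(1)] s, of x] q[OF f(1), of "- x"] f(2) by simp
  qed
  show le: "r x \<le> f x" if "f \<in> C" for f x
    unfolding r_def using that by (intro cINF_lower bdd) auto
  have greatest: "z \<le> r x" if "\<And>f. f \<in> C \<Longrightarrow> z \<le> f x" for x z
    unfolding r_def using that ne by (intro cINF_greatest) auto
  have "r (u + v) \<le> r u + r v" for u v
  proof -
    have "r (u + v) \<le> f u + g v" if fg: "f \<in> C" "g \<in> C" for f g
    proof -
      obtain h where h: "h \<in> C" "h \<le> f" "h \<le> g" using chain[OF fg] fg by blast
      have "r (u + v) \<le> h (u + v)" by (rule le[OF h(1)])
      also have "\<dots> \<le> h u + h v" using sub[OF h(1)] by (auto simp: sublinear_def)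
      also have "\<dots> \<le> f u + g v" using h by (intro add_mono) (auto simp: le_fun_def)
      finally show ?thesis .
    qed
    then have "r (u + v) - g v \<le> r u" if "g \<in> C" for g
      using greatest[of "r (u + v) - g v" u] that by force
    then have "r (u + v) - r u \<le> r v"
      by (intro greatest) (metis diff_le_eq add.commute)
    then show ?thesis by simp
  qed
  moreover have "r (s t x) = t * r x" if t: "0 \<le> t" for t x
  proof (rule antisym)
    show "t * r x \<le> r (s t x)"
    proof (rule greatest)
      fix f assume f: "f \<in> C"
      then have "f (s t x) = t * f x" using sub t by (auto simp: sublinear_def)
      then show "t * r x \<le> f (s t x)" using le[OF f, of x] t by (simp add: mult_left_mono)
    qed
    show "r (s t x) \<le> t * r x"
    proof (cases "t = 0")
      case True
      obtain f where f: "f \<in> C" using ne by blast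
      have "f (s 0 x) = 0" using sub[OF f] unfolding sublinear_def by (metis mult_zero_left order_refl)
      then show ?thesis using le[OF f, of "s t x"] True by simp
    next
      case False
      have "r (s t x) / t \<le> r x"
      proof (rule greatest)
        fix f assume f: "f \<in> C"
        then have "f (s t x) = t * f x" using sub t by (auto simp: sublinear_def)
        then show "r (s t x) / t \<le> f x"
          using le[OF f, of "s t x"] t False by (simp add: field_simps)
      qed
      then show ?thesis using t False by (simp add: field_simps)
    qed
  qed
  ultimately show "sublinear s r" by (auto simp: sublinear_def)
qed

text \<open>A minimal sublinear functional is linear; minimal ones exist by Zorn's lemma.\<close>

theorem Hahn_Banach_sublinear:
  assumes s: "vector_space s" and q: "sublinear s q"
  obtains u where "\<And>x y. u (x + y) = u x + u y" "\<And>t x. u (s t x) = t * u x"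
    "\<And>x. u x \<le> q x" "u z = q z"
proof -
  interpret s: vector_space s by fact
  define q' where "q' = (\<lambda>x. INF t\<in>{0..}. q (x + s t z) - t * q z)"
  have q': "sublinear s q'" "\<And>x t. 0 \<le> t \<Longrightarrow> q' x \<le> q (x + s t z) - t * q z"
    unfolding q'_def using sublinear_cone_inf[OF s q] by auto
  define A where "A = {f. sublinear s f \<and> (\<forall>x. f x \<le> q' x)}"
  define P where "P = (\<lambda>f g :: 'a \<Rightarrow> real. g \<le> f)"
  have "\<exists>m\<in>A. \<forall>f\<in>A. P m f \<longrightarrow> f = m"
  proof (rule predicate_Zorn)
    show "partial_order_on A (relation_of P A)"
      by (rule partial_order_on_relation_ofI) (auto simp: P_def)
    fix C assume C: "C \<in> Chains (relation_of P A)"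
    then have CA: "C \<subseteq> A" by (auto simp: Chains_def relation_of_def)
    show "\<exists>u\<in>A. \<forall>f\<in>C. P f u"
    proof (cases "C = {}")
      case True
      then show ?thesis using q' by (auto simp: A_def)
    next
      case False
      have ch: "f \<le> g \<or> g \<le> f" if "f \<in> C" "g \<in> C" for f g
        using C that by (auto simp: Chains_def relation_of_def P_def)
      have inf: "sublinear s (\<lambda>x. INF f\<in>C. f x)"
        "\<And>f x. f \<in> C \<Longrightarrow> (INF f\<in>C. f x) \<le> f x"
        using sublinear_chain_inf[of s C q', OF s False _ _ ch] CA by (auto simp: A_def subset_eq)
      obtain f where f: "f \<in> C" using False by blast
      have "(INF f\<in>C. f x) \<le> q' x" for x
        using inf(2)[OF f, of x] f CA by (auto simp: A_def subset_eq intro: order_trans)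
      then show ?thesis using inf
        by (intro bexI[of _ "\<lambda>x. INF f\<in>C. f x"]) (auto simp: A_def P_def le_fun_def)
    qed
  qed
  then obtain u where uA: "u \<in> A" and min: "\<And>f. f \<in> A \<Longrightarrow> f \<le> u \<Longrightarrow> f = u"
    by (auto simp: P_def)
  have u: "sublinear s u" "\<And>x. u x \<le> q' x" using uA by (auto simp: A_def)
  have u0: "u 0 = 0" by (rule sublinear_zero[OF u(1) s])
  have superadd: "u x + u y \<le> u (x + y)" for x y
  proof -
    define r where "r = (\<lambda>x. INF t\<in>{0..}. u (x + s t y) - t * u y)"
    have r: "sublinear s r" "\<And>x t. 0 \<le> t \<Longrightarrow> r x \<le> u (x + s t y) - t * u y"
      unfolding r_def using sublinear_cone_inf[OF s u(1)] by auto
    have "r \<le> u" using r(2)[of 0] by (auto simp: le_fun_def)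
    then have "r = u" using r(1) u(2) by (intro min) (auto simp: A_def le_fun_def intro: order_trans)
    then show ?thesis using r(2)[of 1 x] by simp
  qed
  have add: "u (x + y) = u x + u y" for x y
    using superadd[of x y] u(1) by (intro antisym) (auto simp: sublinear_def)
  have minus: "u (- x) = - u x" for x using add[of x "- x"] u0 by simp
  have scale: "u (s t x) = t * u x" for t x
  proof (cases "0 \<le> t")
    case True then show ?thesis using u(1) by (auto simp: sublinear_def)
  next
    case False
    then have "u (s (- t) x) = (- t) * u x"
      using u(1) by (auto simp: sublinear_def simp del: s.scale_minus_left)
    then show ?thesis using minus[of "s t x"] by simp
  qed
  have le: "u x \<le> q x" for x using u(2)[of x] q'(2)[of 0 x] by simp
  have "u (- z) \<le> - q z"
    using u(2)[of "- z"] q'(2)[of 1 "- z"] sublinear_zero[OF q s] by simp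
  then have "u z = q z" using minus[of z] le[of z] by simp
  then show thesis using that add scale le by blast
qed

section \<open>Functionals over the scalar field\<close>

lemma real_or_complex_cases:
  obtains (real) "\<And>c :: 'k::real_or_complex. \<exists>r. c = of_real r"
  | (complex) \<iota> :: "'k::real_or_complex" where "\<iota> * \<iota> = -1" "norm \<iota> = 1"
      "\<And>c. \<exists>r t. c = of_real r + of_real t * \<iota>"
      "\<And>r t. of_real r = of_real t * \<iota> \<Longrightarrow> r = 0"
proof -
  obtain \<phi> :: "'k \<Rightarrow> complex" where add: "\<And>x y. \<phi> (x + y) = \<phi> x + \<phi> y"
    and mult: "\<And>x y. \<phi> (x * y) = \<phi> x * \<phi> y" and re: "\<And>r. \<phi> (scaleR r 1) = of_real r"
    and norm: "\<And>x. norm (\<phi> x) = norm x" and range: "range \<phi> = \<real> \<or> range \<phi> = UNIV"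
    using ex_embedding by blast
  have re': "\<phi> (of_real r) = of_real r" for r using re by (simp add: of_real_def)
  have inj: "x = y" if "\<phi> x = \<phi> y" for x y
  proof -
    have "\<phi> (x - y) = 0" using add[of "x - y" y] that by simp
    then show ?thesis using norm[of "x - y"] by simp
  qed
  show thesis
  proof (cases "range \<phi> = \<real>")
    case True
    have "\<exists>r. c = of_real r" for c :: 'k
    proof -
      have "\<phi> c \<in> \<real>" using True by blast
      then obtain r where "\<phi> c = of_real r" by (auto simp: Reals_def)
      then show ?thesis using inj re' by metis
    qed
    then show thesis by (rule real)
  next
    case False
    then obtain \<iota> where i: "\<phi> \<iota> = \<i>" using range by (metis surjD)
    show thesis
    proof (rule complex)
      have "\<phi> (- 1) = - 1" using re'[of "-1"] by simp
      then show "\<iota> * \<iota> = -1" using i mult by (intro inj) simp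
      show "norm \<iota> = 1" using norm[of \<iota>] i by simp
      show "\<exists>r t. c = of_real r + of_real t * \<iota>" for c
      proof (intro exI inj)
        show "\<phi> c = \<phi> (of_real (Re (\<phi> c)) + of_real (Im (\<phi> c)) * \<iota>)"
          using complex_eq[of "\<phi> c"] by (simp add: add mult re' i mult.commute)
      qed
      show "r = 0" if "of_real r = of_real t * \<iota>" for r t
      proof -
        have "complex_of_real r = of_real t * \<i>" using that mult re' i by metis
        then show ?thesis by (simp add: complex_eq_iff)
      qed
    qed
  qed
qed

lemma (in vector_space) linearI':
  assumes "vector_space s2" "\<And>x y. f (x + y) = f x + f y" "\<And>c x. f (scale c x) = s2 c (f x)"
  shows "Vector_Spaces.linear scale s2 f"
  using assms vector_space_axioms
  by (simp add: Vector_Spaces.linear_iff)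

lemma vector_space_field: "vector_space ((*) :: 'k::field \<Rightarrow> 'k \<Rightarrow> 'k)"
  by unfold_locales (simp_all add: algebra_simps)

lemma Hahn_Banach_seminorm:
  fixes smul :: "'k::real_or_complex \<Rightarrow> 'a::ab_group_add \<Rightarrow> 'a"
  assumes vs: "vector_space smul" and q: "seminorm smul q" and z: "q z \<noteq> 0"
  obtains f where "Vector_Spaces.linear smul (*) f" "\<And>x. norm (f x) \<le> 2 * q x" "f z \<noteq> 0"
proof -
  interpret vector_space smul by fact
  define s where "s = (\<lambda>r::real. smul (of_real r))"
  have s: "vector_space s"
    by unfold_locales (simp_all add: s_def algebra_simps scale_left_distrib scale_right_distrib)
  have qs: "q (smul c x) = norm c * q x" and qadd: "q (x + y) \<le> q x + q y" for c x y
    using q by (auto simp: seminorm_def)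
  have "sublinear s q" by (auto simp: sublinear_def s_def qs qadd)
  then obtain u where u: "\<And>x y. u (x + y) = u x + u y" "\<And>t x. u (s t x) = t * u x"
    "\<And>x. u x \<le> q x" "u z = q z"
    using Hahn_Banach_sublinear[OF s, of q z] by metis
  have umin: "u (- x) = - u x" for x using u(2)[of "-1" x] by (simp add: s_def)
  have "q (- x) = q x" for x using qs[of "-1" x] by simp
  then have uabs: "\<bar>u x\<bar> \<le> q x" for x using u(3)[of x] u(3)[of "- x"] umin[of x] by simp
  show thesis
  proof (cases rule: real_or_complex_cases[where 'k = 'k])
    case real
    define f where "f = (\<lambda>x. of_real (u x) :: 'k)"
    have "f (smul c x) = c * f x" for c x
    proof -
      obtain r where "c = of_real r" using real by blast
      then show ?thesis using u(2)[of r x] by (simp add: f_def s_def)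
    qed
    then have "Vector_Spaces.linear smul (*) f"
      by (intro linearI' vector_space_field) (simp_all add: f_def u(1))
    moreover have "norm (f x) \<le> 2 * q x" for x using uabs[of x] by (simp add: f_def)
    moreover have "f z \<noteq> 0" using u(4) z by (simp add: f_def)
    ultimately show thesis by (rule that)
  next
    case (complex \<iota>)
    define f where "f = (\<lambda>x. of_real (u x) - \<iota> * of_real (u (smul \<iota> x)) :: 'k)"
    have fadd: "f (x + y) = f x + f y" for x y
      by (simp add: f_def u(1) scale_right_distrib algebra_simps)
    have fr: "f (smul (of_real r) x) = of_real r * f x" for r x
    proof -
      have "smul \<iota> (smul (of_real r) x) = s r (smul \<iota> x)" by (simp add: s_def mult.commute)
      then show ?thesis using u(2)[of r x] u(2)[of r "smul \<iota> x"]
        by (simp add: f_def s_def algebra_simps)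
    qed
    have fi: "f (smul \<iota> x) = \<iota> * f x" for x
    proof -
      have "f (smul \<iota> x) = of_real (u (smul \<iota> x)) + \<iota> * of_real (u x)"
        using complex(1) umin[of x] by (simp add: f_def)
      also have "\<dots> = \<iota> * of_real (u x) - (\<iota> * \<iota>) * of_real (u (smul \<iota> x))"
        unfolding complex(1) by simp
      finally show ?thesis by (simp add: f_def algebra_simps)
    qed
    have "f (smul c x) = c * f x" for c x
    proof -
      obtain r t where "c = of_real r + of_real t * \<iota>" using complex(3) by blast
      then have "smul c x = smul (of_real r) x + smul (of_real t) (smul \<iota> x)"
        by (simp add: scale_left_distrib)
      then show ?thesis using \<open>c = _\<close> by (simp only: fadd fr fi) (simp add: algebra_simps)
    qed
    then have "Vector_Spaces.linear smul (*) f" by (intro linearI' vector_space_field fadd)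
    moreover have "norm (f x) \<le> 2 * q x" for x
    proof -
      have "norm (f x) \<le> norm (of_real (u x) :: 'k) + norm (\<iota> * of_real (u (smul \<iota> x)))"
        unfolding f_def by (rule norm_triangle_ineq4)
      also have "\<dots> \<le> q x + q (smul \<iota> x)"
        using uabs[of x] uabs[of "smul \<iota> x"] complex(2) by (simp add: norm_mult)
      finally show ?thesis by (simp add: qs complex(2))
    qed
    moreover have "f z \<noteq> 0"
      using complex(4)[of "u z" "u (smul \<iota> z)"] u(4) z by (auto simp: f_def mult.commute)
    ultimately show thesis by (rule that)
  qed
qed

section \<open>Graded Frechet spaces with a continuous norm\<close>

locale normed_frechet = vector_space smul
  for smul :: "'k::real_or_complex \<Rightarrow> 'a::{ab_group_add,topological_space} \<Rightarrow> 'a" +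
  fixes p :: "nat \<Rightarrow> 'a \<Rightarrow> real"
  assumes frechet: "frechet_topology smul p"
    and p0_eq_0D: "p 0 x = 0 \<Longrightarrow> x = 0"
begin

lemma p_nonneg [simp]: "0 \<le> p n x"
  and p_scale: "p n (smul c x) = norm c * p n x"
  and p_add: "p n (x + y) \<le> p n x + p n y"
  using frechet by (auto simp: frechet_topology_def seminorm_def)

lemma p_mono:
  assumes "m \<le> n" shows "p m x \<le> p n x"
proof -
  have "p i x \<le> p (Suc i) x" for i using frechet by (simp add: frechet_topology_def)
  then show ?thesis using assms by (rule lift_Suc_mono_le)
qed

lemma p_zero [simp]: "p n 0 = 0"
  using p_scale[of n 0 0] by simp

lemma p_minus [simp]: "p n (- x) = p n x"
  using p_scale[of n "- 1" x] by simp

lemma p_diff: "p n (x - y) \<le> p n x + p n y"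
  using p_add[of n x "- y"] by simp

lemma p_commute: "p n (x - y) = p n (y - x)"
  using p_minus[of n "x - y"] by simp

lemma p_triangle: "p n (x - z) \<le> p n (x - y) + p n (y - z)"
  using p_add[of n "x - y" "y - z"] by simp

lemma p_sum: "p n (sum f I) \<le> (\<Sum>i\<in>I. p n (f i))"
  by (induction I rule: infinite_finite_induct) (auto intro: order_trans[OF p_add])

lemma open_iff_p: "open U \<longleftrightarrow> (\<forall>x\<in>U. \<exists>n. \<exists>e>0. {y. p n (y - x) < e} \<subseteq> U)"
  using frechet by (simp add: frechet_topology_def)

lemma open_p_ball: "open {y. p n (y - x) < e}"
  unfolding open_iff_p
proof clarify
  fix z assume z: "p n (z - x) < e"
  have "{y. p n (y - z) < e - p n (z - x)} \<subseteq> {y. p n (y - x) < e}"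
    using p_triangle[of n _ x z] by (smt (verit) mem_Collect_eq subsetI)
  then show "\<exists>m d. 0 < d \<and> {y. p m (y - z) < d} \<subseteq> {y. p n (y - x) < e}"
    using z by (intro exI[of _ n] exI[of _ "e - p n (z - x)"]) auto
qed

lemma closure_p_iff: "x \<in> closure S \<longleftrightarrow> (\<forall>n. \<forall>e>0. \<exists>y\<in>S. p n (y - x) < e)"
proof
  assume x: "x \<in> closure S"
  show "\<forall>n. \<forall>e>0. \<exists>y\<in>S. p n (y - x) < e"
  proof (intro allI impI)
    fix n and e :: real assume "0 < e"
    then have "x \<in> {y. p n (y - x) < e}" by simp
    then have "{y. p n (y - x) < e} \<inter> S \<noteq> {}"
      using x open_p_ball[of n x e] unfolding closure_iff_nhds_not_empty by blast
    then show "\<exists>y\<in>S. p n (y - x) < e" by blast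
  qed
next
  assume S: "\<forall>n. \<forall>e>0. \<exists>y\<in>S. p n (y - x) < e"
  show "x \<in> closure S"
    unfolding closure_iff_nhds_not_empty
  proof (intro allI impI)
    fix V U :: "'a set" assume "U \<subseteq> V" "open U" "x \<in> U"
    then obtain n e where ne: "e > 0" "{y. p n (y - x) < e} \<subseteq> U" unfolding open_iff_p by blast
    obtain y where "y \<in> S" "p n (y - x) < e" using S ne(1) by blast
    then show "S \<inter> V \<noteq> {}" using ne \<open>U \<subseteq> V\<close> by blast
  qed
qed

lemma dense_p_iff: "closure S = UNIV \<longleftrightarrow> (\<forall>x n e. e > 0 \<longrightarrow> (\<exists>y\<in>S. p n (y - x) < e))"
  by (auto simp: set_eq_iff closure_p_iff)

lemma LIMSEQ_p_iff: "s \<longlonglongrightarrow> l \<longleftrightarrow> (\<forall>k. (\<lambda>n. p k (s n - l)) \<longlonglongrightarrow> 0)"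
proof
  assume s: "s \<longlonglongrightarrow> l"
  show "\<forall>k. (\<lambda>n. p k (s n - l)) \<longlonglongrightarrow> 0"
  proof
    fix k show "(\<lambda>n. p k (s n - l)) \<longlonglongrightarrow> 0"
    proof (rule order_tendstoI)
      fix e :: real assume "0 < e"
      then show "\<forall>\<^sub>F n in sequentially. p k (s n - l) < e"
        using topological_tendstoD[OF s open_p_ball[of k l e]] by simp
    next
      fix e :: real assume "e < 0"
      then show "\<forall>\<^sub>F n in sequentially. e < p k (s n - l)"
        using p_nonneg by (auto intro!: always_eventually less_le_trans[of e 0])
    qed
  qed
next
  assume s: "\<forall>k. (\<lambda>n. p k (s n - l)) \<longlonglongrightarrow> 0"
  show "s \<longlonglongrightarrow> l"
  proof (rule topological_tendstoI)
    fix U assume "open U" "l \<in> U"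
    then obtain k e where ke: "e > 0" "{y. p k (y - l) < e} \<subseteq> U" unfolding open_iff_p by blast
    have "\<forall>\<^sub>F n in sequentially. p k (s n - l) < e" using s ke(1) order_tendstoD(2) by blast
    then show "\<forall>\<^sub>F n in sequentially. s n \<in> U" by eventually_elim (use ke in auto)
  qed
qed

lemma LIMSEQ_p_unique:
  fixes s :: "nat \<Rightarrow> 'a"
  assumes "s \<longlonglongrightarrow> l" "s \<longlonglongrightarrow> l'"
  shows "l = l'"
proof -
  have "(\<lambda>n. p 0 (s n - l) + p 0 (s n - l')) \<longlonglongrightarrow> 0 + 0"
    using assms LIMSEQ_p_iff by (intro tendsto_add) auto
  moreover have "p 0 (l - l') \<le> p 0 (s n - l) + p 0 (s n - l')" for n
    using p_triangle[of 0 l l' "s n"] p_commute[of 0 l "s n"] by simp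
  ultimately have "p 0 (l - l') \<le> 0" by (auto intro: LIMSEQ_le_const)
  then show ?thesis using p0_eq_0D[of "l - l'"] p_nonneg[of 0 "l - l'"] by simp
qed

lemma LIMSEQ_p_add:
  fixes s t :: "nat \<Rightarrow> 'a"
  assumes "s \<longlonglongrightarrow> a" "t \<longlonglongrightarrow> b"
  shows "(\<lambda>n. s n + t n) \<longlonglongrightarrow> a + b"
  unfolding LIMSEQ_p_iff
proof
  fix k
  have "(\<lambda>n. p k (s n - a)) \<longlonglongrightarrow> 0" "(\<lambda>n. p k (t n - b)) \<longlonglongrightarrow> 0"
    using assms by (auto simp: LIMSEQ_p_iff)
  from tendsto_add[OF this] have lim: "(\<lambda>n. p k (s n - a) + p k (t n - b)) \<longlonglongrightarrow> 0" by simp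
  have "p k (s n + t n - (a + b)) \<le> p k (s n - a) + p k (t n - b)" for n
    using p_add[of k "s n - a" "t n - b"] by (simp add: add_diff_add)
  then show "(\<lambda>n. p k (s n + t n - (a + b))) \<longlonglongrightarrow> 0"
    by (intro tendsto_sandwich[OF _ _ tendsto_const lim]) (auto intro!: always_eventually)
qed

lemma LIMSEQ_p_scale:
  fixes s :: "nat \<Rightarrow> 'a"
  assumes "s \<longlonglongrightarrow> a"
  shows "(\<lambda>n. smul c (s n)) \<longlonglongrightarrow> smul c a"
  unfolding LIMSEQ_p_iff
proof
  fix k
  have "(\<lambda>n. norm c * p k (s n - a)) \<longlonglongrightarrow> norm c * 0"
    using assms by (intro tendsto_intros) (auto simp: LIMSEQ_p_iff)
  then show "(\<lambda>n. p k (smul c (s n) - smul c a)) \<longlonglongrightarrow> 0"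
    by (simp add: p_scale flip: scale_right_diff_distrib)
qed

lemma Cauchy_p_convergent:
  fixes s :: "nat \<Rightarrow> 'a"
  assumes "\<And>n e. e > 0 \<Longrightarrow> \<exists>M. \<forall>i\<ge>M. \<forall>j\<ge>M. p n (s i - s j) < e"
  obtains l where "s \<longlonglongrightarrow> l"
proof -
  have "(\<forall>n. \<forall>e>0. \<exists>M. \<forall>i\<ge>M. \<forall>j\<ge>M. p n (s i - s j) < e) \<longrightarrow> (\<exists>l. s \<longlonglongrightarrow> l)"
    using frechet unfolding frechet_topology_def by (elim conjE) (erule spec)
  then show thesis using assms that by auto
qed

lemma p_summable_Cauchy:
  fixes s :: "nat \<Rightarrow> 'a"
  assumes d: "summable d" and s: "\<forall>\<^sub>F i in sequentially. p n (s (Suc i) - s i) \<le> d i" and e: "e > 0"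
  shows "\<exists>M. \<forall>i\<ge>M. \<forall>j\<ge>M. p n (s i - s j) < e"
proof -
  obtain N where N: "\<And>i. i \<ge> N \<Longrightarrow> p n (s (Suc i) - s i) \<le> d i"
    using s by (auto simp: eventually_sequentially)
  have tel: "p n (s j - s i) \<le> sum d {i..<j}" if "N \<le> i" "i \<le> j" for i j
    using that(2)
  proof (induction j rule: dec_induct)
    case (step j)
    then show ?case using p_triangle[of n "s (Suc j)" "s i" "s j"] N[of j] that(1) by simp
  qed simp
  obtain M where M: "\<And>i j. M \<le> i \<Longrightarrow> norm (sum d {i..<j}) < e"
    using summable_Cauchy[of d] d e by metis
  have "p n (s i - s j) < e" if "max N M \<le> i" "max N M \<le> j" for i j
  proof (cases "i \<le> j")
    case True
    then show ?thesis using tel[of i j] M[of i j] that p_commute[of n "s i" "s j"] by simp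
  next
    case False
    then show ?thesis using tel[of j i] M[of j i] that by simp
  qed
  then show ?thesis by blast
qed

lemma continuous_if_p_bounded:
  assumes lin: "Vector_Spaces.linear smul smul T"
    and bdd: "\<And>k. \<exists>j C. \<forall>x. p k (T x) \<le> C * p j x"
  shows "continuous_on UNIV T"
  unfolding continuous_on_open_vimage[OF open_UNIV]
proof (intro allI impI)
  interpret T: Vector_Spaces.linear smul smul T by fact
  fix U :: "'a set" assume U: "open U"
  have "open (T -` U)"
    unfolding open_iff_p
  proof
    fix x assume "x \<in> T -` U"
    then obtain k e where ke: "e > 0" "{y. p k (y - T x) < e} \<subseteq> U" using U unfolding open_iff_p by blast
    obtain j C where C: "\<And>x. p k (T x) \<le> C * p j x" using bdd[of k] by blast
    define C' where "C' = \<bar>C\<bar> + 1"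
    have C': "C' > 0" "p k (T x) \<le> C' * p j x" for x
      using order_trans[OF C mult_right_mono[of C C', OF _ p_nonneg]] by (auto simp: C'_def)
    have "T y \<in> U" if "p j (y - x) < e / C'" for y
    proof -
      have "p k (T y - T x) \<le> C' * p j (y - x)" using C'(2)[of "y - x"] by (simp add: T.diff)
      also have "\<dots> < e" using that C'(1) by (simp add: field_simps)
      finally show ?thesis using ke by auto
    qed
    then show "\<exists>n. \<exists>e>0. {y. p n (y - x) < e} \<subseteq> T -` U"
      using ke(1) C'(1) by (intro exI[of _ j] exI[of _ "e / C'"]) auto
  qed
  then show "open (T -` U \<inter> UNIV)" by simp
qed

definition p0_functional :: "('a \<Rightarrow> 'k) \<Rightarrow> bool" where
  "p0_functional f \<longleftrightarrow> Vector_Spaces.linear smul (*) f \<and> (\<forall>x. norm (f x) \<le> p 0 x)"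

definition p0_operator :: "('a \<Rightarrow> 'a) \<Rightarrow> bool" where
  "p0_operator K \<longleftrightarrow>
     Vector_Spaces.linear smul smul K \<and> (\<forall>k. \<exists>C\<ge>0. \<forall>x. p k (K x) \<le> C * p 0 x)"

lemma linear_compI:
  assumes "Vector_Spaces.linear smul smul R" "Vector_Spaces.linear smul smul S"
  shows "Vector_Spaces.linear smul smul (\<lambda>x. R (S x))"
  using Vector_Spaces.linear_compose[OF assms(2,1)] by (simp add: o_def)

lemma linear_addI:
  assumes "Vector_Spaces.linear smul smul R" "Vector_Spaces.linear smul smul S"
  shows "Vector_Spaces.linear smul smul (\<lambda>x. R x + S x)"
  using assms by (simp add: Vector_Spaces.linear_iff algebra_simps scale_right_distrib)

lemma linear_scaleI:
  assumes "Vector_Spaces.linear smul smul R"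
  shows "Vector_Spaces.linear smul smul (\<lambda>x. smul c (R x))"
  using assms by (simp add: Vector_Spaces.linear_iff scale_right_distrib mult.commute)

lemma linear_rank_oneI:
  assumes "Vector_Spaces.linear smul (*) f"
  shows "Vector_Spaces.linear smul smul (\<lambda>x. smul (f x) y)"
  using assms vector_space_axioms by (simp add: Vector_Spaces.linear_iff scale_left_distrib)

lemma linear_zeroI: "Vector_Spaces.linear smul smul (\<lambda>x. 0)"
  using vector_space_axioms by (simp add: Vector_Spaces.linear_iff)

lemma p0_functional_zero: "p0_functional (\<lambda>x. 0)"
  using vector_space_axioms vector_space_field
  by (auto simp: p0_functional_def Vector_Spaces.linear_iff)

lemma p0_operator_bound:
  assumes "p0_operator K" obtains C where "C \<ge> 0" "\<And>x. p k (K x) \<le> C * p 0 x"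
  using assms by (auto simp: p0_operator_def)

lemma p0_operator_zero: "p0_operator (\<lambda>x. 0)"
  using linear_zeroI by (auto simp: p0_operator_def intro: exI[of _ 0])

lemma p0_operator_add:
  assumes "p0_operator K" "p0_operator L"
  shows "p0_operator (\<lambda>x. K x + L x)"
  unfolding p0_operator_def
proof (intro conjI allI)
  show "Vector_Spaces.linear smul smul (\<lambda>x. K x + L x)"
    using assms by (intro linear_addI) (auto simp: p0_operator_def)
  fix k
  obtain C D where "C \<ge> 0" "D \<ge> 0" "\<And>x. p k (K x) \<le> C * p 0 x" "\<And>x. p k (L x) \<le> D * p 0 x"
    using p0_operator_bound[of K k] p0_operator_bound[of L k] assms by metis
  then show "\<exists>C\<ge>0. \<forall>x. p k (K x + L x) \<le> C * p 0 x"
    by (intro exI[of _ "C + D"]) (auto simp: distrib_right intro!: order_trans[OF p_add] add_mono)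
qed

lemma p0_operator_rank_one:
  assumes f: "p0_functional f"
  shows "p0_operator (\<lambda>x. smul (f x) y)"
  unfolding p0_operator_def
proof (intro conjI allI)
  show "Vector_Spaces.linear smul smul (\<lambda>x. smul (f x) y)"
    using f by (intro linear_rank_oneI) (auto simp: p0_functional_def)
  fix k
  show "\<exists>C\<ge>0. \<forall>x. p k (smul (f x) y) \<le> C * p 0 x"
    using f by (intro exI[of _ "p k y"])
      (auto simp: p_scale p0_functional_def mult.commute[of "p k y"] intro!: mult_right_mono)
qed

lemma continuous_linear_id_plus:
  assumes "p0_operator K"
  shows "continuous_linear smul smul (\<lambda>x. x + K x)"
  unfolding continuous_linear_def
proof
  show lin: "Vector_Spaces.linear smul smul (\<lambda>x. x + K x)"
    using assms linear_addI[OF linear_ident] by (auto simp: p0_operator_def)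
  show "continuous_on UNIV (\<lambda>x. x + K x)"
  proof (rule continuous_if_p_bounded[OF lin])
    fix k
    obtain C where C: "C \<ge> 0" "\<And>x. p k (K x) \<le> C * p 0 x" using p0_operator_bound assms by blast
    have "p k (x + K x) \<le> (1 + C) * p k x" for x
    proof -
      have "p k (K x) \<le> C * p k x" using C p_mono[of 0 k x] by (meson le0 mult_left_mono order_trans)
      then show ?thesis using p_add[of k x "K x"] by (simp add: algebra_simps)
    qed
    then show "\<exists>j C. \<forall>x. p k (x + K x) \<le> C * p j x" by blast
  qed
qed

text \<open>Neumann series; the contraction estimate is needed in the norm \<^term>\<open>p 0\<close> only, since
  \<^term>\<open>K\<close> maps \<^term>\<open>p 0\<close>-Cauchy sequences to sequences that are Cauchy in every seminorm.\<close>

lemma id_plus_contraction_surj: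
  assumes K: "p0_operator K" and half: "\<And>x. p 0 (K x) \<le> 1 / 2 * p 0 x"
  shows "\<exists>x. x + K x = y"
proof -
  interpret K: Vector_Spaces.linear smul smul K using K by (simp add: p0_operator_def)
  define s where "s = rec_nat 0 (\<lambda>_ x. y - K x)"
  have s: "s 0 = 0" "s (Suc n) = y - K (s n)" for n by (simp_all add: s_def)
  have diff: "s (Suc (Suc n)) - s (Suc n) = - K (s (Suc n) - s n)" for n
    unfolding s(2)[of "Suc n"] s(2)[of n] K.diff by simp
  have p0: "p 0 (s (Suc n) - s n) \<le> (1 / 2) ^ n * p 0 y" for n
  proof (induction n)
    case (Suc n)
    then show ?case unfolding diff using half[of "s (Suc n) - s n"] by simp
  qed (simp add: s)
  have "\<exists>M. \<forall>i\<ge>M. \<forall>j\<ge>M. p k (s i - s j) < e" if "e > 0" for k e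
  proof -
    obtain C where C: "C \<ge> 0" "\<And>x. p k (K x) \<le> C * p 0 x" using p0_operator_bound K by blast
    have "summable (\<lambda>n. C * (2 * p 0 y) * (1 / 2) ^ n)" by (intro summable_mult) simp
    moreover have "p k (s (Suc n) - s n) \<le> C * (2 * p 0 y) * (1 / 2) ^ n" if n: "n \<ge> 1" for n
    proof -
      obtain m where "n = Suc m" using n by (cases n) auto
      moreover have "p k (K (s (Suc m) - s m)) \<le> C * (p 0 y * (1 / 2) ^ m)"
        using C(2)[of "s (Suc m) - s m"] mult_left_mono[OF p0[of m] C(1)] by (simp add: mult.commute)
      ultimately show ?thesis using diff[of m] by simp
    qed
    then have "\<forall>\<^sub>F n in sequentially. p k (s (Suc n) - s n) \<le> C * (2 * p 0 y) * (1 / 2) ^ n"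
      by (auto simp: eventually_sequentially)
    ultimately show ?thesis using that by (rule p_summable_Cauchy)
  qed
  then obtain l where l: "s \<longlonglongrightarrow> l" by (rule Cauchy_p_convergent)
  have "(\<lambda>n. s (Suc n) + K (s n)) \<longlonglongrightarrow> l + K l"
    unfolding LIMSEQ_p_iff
  proof
    fix k
    obtain C where C: "C \<ge> 0" "\<And>x. p k (K x) \<le> C * p 0 x" using p0_operator_bound K by blast
    have lp: "(\<lambda>n. p j (s n - l)) \<longlonglongrightarrow> 0" for j using l by (simp add: LIMSEQ_p_iff)
    have "(\<lambda>n. p k (s (Suc n) - l) + C * p 0 (s n - l)) \<longlonglongrightarrow> 0 + C * 0"
      by (intro tendsto_intros LIMSEQ_Suc lp)
    then have lim: "(\<lambda>n. p k (s (Suc n) - l) + C * p 0 (s n - l)) \<longlonglongrightarrow> 0" by simp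
    have "p k (s (Suc n) + K (s n) - (l + K l)) \<le> p k (s (Suc n) - l) + C * p 0 (s n - l)" for n
    proof -
      have "s (Suc n) + K (s n) - (l + K l) = (s (Suc n) - l) + K (s n - l)"
        by (simp add: K.diff)
      then have "p k (s (Suc n) + K (s n) - (l + K l)) \<le> p k (s (Suc n) - l) + p k (K (s n - l))"
        using p_add[of k "s (Suc n) - l" "K (s n - l)"] by (simp only:)
      then show ?thesis using C(2)[of "s n - l"] by linarith
    qed
    then show "(\<lambda>n. p k (s (Suc n) + K (s n) - (l + K l))) \<longlonglongrightarrow> 0"
      by (intro tendsto_sandwich[OF _ _ tendsto_const lim]) (auto intro!: always_eventually)
  qed
  then have "(\<lambda>n. y) \<longlonglongrightarrow> l + K l" by (simp add: s)
  then have "l + K l = y" by (rule LIMSEQ_p_unique) (rule tendsto_const)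
  then show ?thesis by blast
qed

lemma id_plus_contraction_inverse:
  assumes K: "p0_operator K" and half: "\<And>x. p 0 (K x) \<le> 1 / 2 * p 0 x"
  obtains S where "continuous_linear smul smul S" "\<And>x. S (x + K x) = x" "\<And>x. S x + K (S x) = x"
proof -
  interpret K: Vector_Spaces.linear smul smul K using K by (simp add: p0_operator_def)
  define J where "J = (\<lambda>x. x + K x)"
  have J: "Vector_Spaces.linear smul smul J"
    using continuous_linear_id_plus[OF K] by (simp add: continuous_linear_def J_def)
  interpret J: Vector_Spaces.linear smul smul J by (rule J)
  have "x = 0" if "J x = 0" for x
  proof -
    have "K x = - x" using that by (simp add: J_def eq_neg_iff_add_eq_0 add.commute)
    then have "p 0 x \<le> 1 / 2 * p 0 x" using half[of x] by simp
    then show ?thesis using p0_eq_0D[of x] p_nonneg[of 0 x] by simp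
  qed
  then have "inj J" using J.inj_iff_eq_0 by blast
  moreover have "\<exists>x. y = J x" for y
    using id_plus_contraction_surj[OF K half, of y] unfolding J_def by (auto intro: sym)
  then have "surj J" by (simp add: surj_def)
  ultimately have bij: "bij J" by (simp add: bij_def)
  define S where "S = inv J"
  have SJ: "S (J x) = x" and JS: "J (S x) = x" for x
    using bij by (simp_all add: S_def bij_is_inj bij_is_surj surj_f_inv_f)
  have S: "Vector_Spaces.linear smul smul S"
  proof (intro linearI' vector_space_axioms)
    show "S (x + y) = S x + S y" for x y
      using SJ[of "S x + S y"] by (simp add: J.add JS)
    show "S (smul c x) = smul c (S x)" for c x
      using SJ[of "smul c (S x)"] by (simp add: J.scale JS)
  qed
  have p0S: "p 0 (S y) \<le> 2 * p 0 y" for y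
  proof -
    have "S y = y - K (S y)" using JS[of y] by (simp add: J_def algebra_simps)
    then have "p 0 (S y) \<le> p 0 y + p 0 (K (S y))" using p_diff[of 0 y "K (S y)"] by simp
    then show ?thesis using half[of "S y"] by simp
  qed
  have "continuous_on UNIV S"
  proof (rule continuous_if_p_bounded[OF S])
    fix k
    obtain C where C: "C \<ge> 0" "\<And>x. p k (K x) \<le> C * p 0 x" using p0_operator_bound K by blast
    have "p k (S y) \<le> (1 + C * 2) * p k y" for y
    proof -
      have "S y = y - K (S y)" using JS[of y] by (simp add: J_def algebra_simps)
      then have "p k (S y) \<le> p k y + p k (K (S y))" using p_diff[of k y "K (S y)"] by simp
      also have "p k (K (S y)) \<le> C * p 0 (S y)" by (rule C(2))
      also have "\<dots> \<le> C * (2 * p k y)"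
        using p0S[of y] p_mono[of 0 k y] C(1) by (intro mult_left_mono) auto
      finally show ?thesis by (simp add: algebra_simps)
    qed
    then show "\<exists>j C. \<forall>x. p k (S x) \<le> C * p j x" by blast
  qed
  then have "continuous_linear smul smul S" using S by (simp add: continuous_linear_def)
  then show thesis using SJ JS unfolding J_def by (rule that)
qed

end

lemma nuclear_compose:
  fixes smul :: "'k::real_normed_field \<Rightarrow> 'a::{ab_group_add,topological_space} \<Rightarrow> 'a"
  assumes R: "continuous_linear smul smul R" and K: "nuclear smul K" and S: "continuous_linear smul smul S"
  shows "nuclear smul (\<lambda>x. R (K (S x)))"
proof -
  interpret R: Vector_Spaces.linear smul smul R using R by (simp add: continuous_linear_def)
  interpret S: Vector_Spaces.linear smul smul S using S by (simp add: continuous_linear_def)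
  have Rc: "continuous_on UNIV R" and Sc: "continuous_on UNIV S"
    using R S by (auto simp: continuous_linear_def)
  obtain l f v where sum: "summable (\<lambda>n. norm (l n))" and f: "\<And>n. continuous_linear smul (*) (f n)"
    and equi: "equicontinuous f" and v: "tvs_bounded smul (range v)"
    and K: "\<And>x. (\<lambda>n. smul (l n * f n x) (v n)) sums K x"
    using K unfolding nuclear_def by blast
  have "continuous_linear smul (*) (\<lambda>x. f n (S x))" for n
  proof -
    have "Vector_Spaces.linear smul (*) (f n)" "continuous_on UNIV (f n)"
      using f[of n] by (auto simp: continuous_linear_def)
    then show ?thesis
      using Vector_Spaces.linear_compose[OF S.linear_axioms, of "(*)" "f n"]
        continuous_on_compose2[OF _ Sc, of UNIV "f n"]
      by (simp add: continuous_linear_def o_def)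
  qed
  moreover have "equicontinuous (\<lambda>n x. f n (S x))"
    unfolding equicontinuous_def
  proof (intro allI impI)
    fix x and e :: real assume "0 < e"
    then obtain U where U: "open U" "S x \<in> U" "\<forall>n. \<forall>y\<in>U. dist (f n y) (f n (S x)) < e"
      using equi unfolding equicontinuous_def by meson
    have "open (S -` U)" using U(1) Sc by (metis continuous_on_open_vimage inf_top.right_neutral open_UNIV)
    then show "\<exists>U. open U \<and> x \<in> U \<and> (\<forall>n. \<forall>y\<in>U. dist (f n (S y)) (f n (S x)) < e)"
      using U by (intro exI[of _ "S -` U"]) auto
  qed
  moreover have "tvs_bounded smul (range (\<lambda>n. R (v n)))"
    unfolding tvs_bounded_def
  proof (intro allI impI)
    fix U :: "'a set" assume U: "open U \<and> 0 \<in> U"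
    have "open (R -` U)" using U Rc by (metis continuous_on_open_vimage inf_top.right_neutral open_UNIV)
    moreover have "0 \<in> R -` U" using U by simp
    ultimately obtain r where r: "r > 0" "\<And>c. r \<le> norm c \<Longrightarrow> range v \<subseteq> smul c ` (R -` U)"
      using v unfolding tvs_bounded_def by meson
    have "range (\<lambda>n. R (v n)) \<subseteq> smul c ` U" if c: "r \<le> norm c" for c
    proof clarify
      fix n
      obtain z where "z \<in> R -` U" "v n = smul c z" using r(2)[OF c] by blast
      then show "R (v n) \<in> smul c ` U" by (auto simp: R.scale)
    qed
    then show "\<exists>r>0. \<forall>c. r \<le> norm c \<longrightarrow> range (\<lambda>n. R (v n)) \<subseteq> smul c ` U" using r(1) by blast
  qed
  moreover have "(\<lambda>n. smul (l n * f n (S x)) (R (v n))) sums R (K (S x))" for x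
  proof -
    have "(\<lambda>n. R (\<Sum>i<n. smul (l i * f i (S x)) (v i))) \<longlonglongrightarrow> R (K (S x))"
      using K[of "S x"] unfolding sums_def by (rule continuous_on_tendsto_compose[OF Rc]) auto
    then show ?thesis by (simp add: sums_def R.sum R.scale)
  qed
  ultimately show ?thesis unfolding nuclear_def using sum
    by (intro exI[of _ l] exI[of _ "\<lambda>n x. f n (S x)"] exI[of _ "\<lambda>n. R (v n)"]) blast
qed

context normed_frechet
begin

lemma p0_functional_continuous_linear:
  assumes "p0_functional f"
  shows "continuous_linear smul (*) f"
proof -
  interpret f: Vector_Spaces.linear smul "(*)" f using assms by (simp add: p0_functional_def)
  have "open (f -` U)" if U: "open U" for U
    unfolding open_iff_p
  proof
    fix x assume "x \<in> f -` U"
    then obtain e where e: "e > 0" "ball (f x) e \<subseteq> U"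
      using U unfolding open_contains_ball by auto
    have "f y \<in> ball (f x) e" if "p 0 (y - x) < e" for y
    proof -
      have "dist (f x) (f y) = norm (f (y - x))" by (simp add: f.diff dist_norm norm_minus_commute)
      also have "\<dots> \<le> p 0 (y - x)" using assms by (auto simp: p0_functional_def)
      finally show ?thesis using that by simp
    qed
    then show "\<exists>n. \<exists>e>0. {y. p n (y - x) < e} \<subseteq> f -` U" using e by blast
  qed
  then show ?thesis using f.linear_axioms
    by (simp add: continuous_linear_def continuous_on_open_vimage[OF open_UNIV])
qed

lemma p0_functional_equicontinuous:
  assumes f: "\<And>n. p0_functional (f n)"
  shows "equicontinuous f"
  unfolding equicontinuous_def
proof (intro allI impI)
  fix x and e :: real assume "0 < e"
  moreover have "dist (f n y) (f n x) < e" if "p 0 (y - x) < e" for n y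
  proof -
    interpret f: Vector_Spaces.linear smul "(*)" "f n" using f by (simp add: p0_functional_def)
    have "norm (f n (y - x)) \<le> p 0 (y - x)" using f by (auto simp: p0_functional_def)
    then show ?thesis using that by (simp add: f.diff dist_norm)
  qed
  ultimately show "\<exists>U. open U \<and> x \<in> U \<and> (\<forall>n. \<forall>y\<in>U. dist (f n y) (f n x) < e)"
    using open_p_ball[of 0 x e] by (intro exI[of _ "{y. p 0 (y - x) < e}"]) auto
qed

lemma tvs_bounded_p:
  assumes "\<And>k. \<exists>C. \<forall>x\<in>S. p k x \<le> C"
  shows "tvs_bounded smul S"
  unfolding tvs_bounded_def
proof (intro allI impI)
  fix U :: "'a set" assume "open U \<and> 0 \<in> U"
  then obtain k e where ke: "e > 0" "{y. p k (y - 0) < e} \<subseteq> U" unfolding open_iff_p by metis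
  obtain C where C: "\<And>x. x \<in> S \<Longrightarrow> p k x \<le> C" using assms by blast
  define r where "r = (\<bar>C\<bar> + 1) / e"
  have r: "r > 0" using ke(1) by (simp add: r_def)
  have "S \<subseteq> smul c ` U" if c: "r \<le> norm c" for c
  proof
    fix x assume x: "x \<in> S"
    have c0: "norm c > 0" using c r by linarith
    have "p k x < \<bar>C\<bar> + 1" using C[OF x] by linarith
    also have "\<dots> = r * e" using ke(1) by (simp add: r_def)
    also have "\<dots> \<le> norm c * e" using c ke(1) by simp
    finally have "p k x / norm c < e" using c0 by (simp add: pos_divide_less_eq mult.commute)
    then have "p k (smul (inverse c) x) < e"
      by (simp add: p_scale norm_inverse divide_inverse mult.commute)
    then have "smul (inverse c) x \<in> U" using ke(2) by auto
    then show "x \<in> smul c ` U" using c0 by (intro image_eqI[of _ _ "smul (inverse c) x"]) auto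
  qed
  then show "\<exists>r>0. \<forall>c. r \<le> norm c \<longrightarrow> S \<subseteq> smul c ` U" using r by blast
qed

lemma rank_one_series:
  fixes f :: "nat \<Rightarrow> 'a \<Rightarrow> 'k" and y :: "nat \<Rightarrow> 'a"
  assumes f: "\<And>n. p0_functional (f n)" and y: "\<And>n. p n (y n) \<le> (1 / 4) ^ Suc n"
  obtains K where "p0_operator K" "nuclear smul K" "\<And>x. p 0 (K x) \<le> 1 / 2 * p 0 x"
    "\<And>x. (\<lambda>n. smul (f n x) (y n)) sums K x"
proof -
  have fn: "norm (f n x) \<le> p 0 x" for n x using f by (auto simp: p0_functional_def)
  have ykn: "p k (y n) \<le> (1 / 4) ^ Suc n" if "k \<le> n" for k n
    using y[of n] p_mono[OF that, of "y n"] by linarith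
  have geo: "summable (\<lambda>n. (1 / 4 :: real) ^ Suc n)" "(\<Sum>n. (1 / 4 :: real) ^ Suc n) \<le> 1 / 2"
    using sums_mult[OF geometric_sums[of "1 / 4 :: real"], of "1 / 4"]
    by (auto dest: sums_summable simp flip: sums_unique)
  have sy: "summable (\<lambda>n. p k (y n))" for k
    by (rule summable_comparison_test_ev[OF _ geo(1)])
      (use ykn in \<open>auto simp: eventually_sequentially intro!: exI[of _ k]\<close>)
  define s where "s = (\<lambda>x n. \<Sum>i<n. smul (f i x) (y i))"
  have "\<exists>l. s x \<longlonglongrightarrow> l" for x
  proof -
    have "\<exists>M. \<forall>i\<ge>M. \<forall>j\<ge>M. p k (s x i - s x j) < e" if "e > 0" for k e
    proof (rule p_summable_Cauchy[OF _ _ that])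
      show "summable (\<lambda>n. p 0 x * p k (y n))" using sy by (rule summable_mult)
      show "\<forall>\<^sub>F i in sequentially. p k (s x (Suc i) - s x i) \<le> p 0 x * p k (y i)"
        by (auto simp: s_def p_scale intro!: always_eventually mult_right_mono fn)
    qed
    then show ?thesis by (rule Cauchy_p_convergent) blast+
  qed
  then obtain K where K: "\<And>x. s x \<longlonglongrightarrow> K x" by metis
  have sums: "(\<lambda>n. smul (f n x) (y n)) sums K x" for x using K by (simp add: sums_def s_def)
  have add: "K (u + v) = K u + K v" for u v
  proof (rule LIMSEQ_p_unique[OF K])
    have "f i (u + v) = f i u + f i v" for i
      using f[of i] by (simp add: p0_functional_def Vector_Spaces.linear_iff)
    then have "s (u + v) = (\<lambda>n. s u n + s v n)" by (simp add: s_def scale_left_distrib sum.distrib)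
    then show "s (u + v) \<longlonglongrightarrow> K u + K v" using LIMSEQ_p_add[OF K K] by simp
  qed
  have scale: "K (smul c u) = smul c (K u)" for c u
  proof (rule LIMSEQ_p_unique[OF K])
    have "f i (smul c u) = c * f i u" for i
      using f[of i] by (simp add: p0_functional_def Vector_Spaces.linear_iff)
    then have "s (smul c u) = (\<lambda>n. smul c (s u n))" by (simp add: s_def scale_sum_right)
    then show "s (smul c u) \<longlonglongrightarrow> smul c (K u)" using LIMSEQ_p_scale[OF K] by simp
  qed
  have bound: "p k (K x) \<le> (\<Sum>n. p k (y n)) * p 0 x" for k x
  proof -
    have sn: "p k (s x n) \<le> (\<Sum>n. p k (y n)) * p 0 x" for n
    proof -
      have "p k (s x n) \<le> (\<Sum>i<n. p k (smul (f i x) (y i)))" unfolding s_def by (rule p_sum)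
      also have "\<dots> \<le> (\<Sum>i<n. p k (y i) * p 0 x)"
        by (intro sum_mono) (simp add: p_scale mult.commute[of "p k _"] mult_right_mono fn)
      also have "\<dots> \<le> (\<Sum>n. p k (y n)) * p 0 x"
        unfolding sum_distrib_right[symmetric] by (intro mult_right_mono sum_le_suminf sy) auto
      finally show ?thesis .
    qed
    have "(\<lambda>n. p k (s x n - K x)) \<longlonglongrightarrow> 0" using K LIMSEQ_p_iff by auto
    from tendsto_add[OF this tendsto_const]
    have "(\<lambda>n. p k (s x n - K x) + (\<Sum>n. p k (y n)) * p 0 x) \<longlonglongrightarrow> (\<Sum>n. p k (y n)) * p 0 x" by simp
    moreover have "p k (K x) \<le> p k (s x n - K x) + (\<Sum>n. p k (y n)) * p 0 x" for n
      using sn[of n] p_triangle[of k "K x" 0 "s x n"] p_commute[of k "K x" "s x n"] by simp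
    ultimately show ?thesis by (auto intro: LIMSEQ_le_const)
  qed
  have K0: "p0_operator K"
    unfolding p0_operator_def
  proof (intro conjI allI)
    show "Vector_Spaces.linear smul smul K" by (intro linearI' vector_space_axioms add scale)
    show "\<exists>C\<ge>0. \<forall>x. p k (K x) \<le> C * p 0 x" for k
      using bound[of k] by (intro exI[of _ "\<Sum>n. p k (y n)"]) (auto intro: suminf_nonneg sy)
  qed
  have "p 0 (K x) \<le> 1 / 2 * p 0 x" for x
  proof -
    have "(\<Sum>n. p 0 (y n)) \<le> (\<Sum>n. (1 / 4 :: real) ^ Suc n)"
      by (rule suminf_le[OF _ sy geo(1)]) (rule ykn, simp)
    then have "(\<Sum>n. p 0 (y n)) * p 0 x \<le> 1 / 2 * p 0 x" using geo(2) by (intro mult_right_mono) auto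
    then show ?thesis using bound[of 0 x] by linarith
  qed
  moreover have "nuclear smul K"
    unfolding nuclear_def
  proof (intro exI conjI allI)
    define l where "l = (\<lambda>n. of_real ((1 / 2) ^ n) :: 'k)"
    define v where "v = (\<lambda>n. smul (of_real (2 ^ n)) (y n))"
    show "summable (\<lambda>n. norm (l n))" by (simp add: l_def norm_power norm_divide)
    show "continuous_linear smul (*) (f n)" for n using f by (rule p0_functional_continuous_linear)
    show "equicontinuous f" using f by (rule p0_functional_equicontinuous)
    show "tvs_bounded smul (range v)"
    proof (rule tvs_bounded_p)
      fix k
      have vn: "p k (v n) \<le> 1" if "k \<le> n" for n
      proof -
        have "p k (v n) \<le> 2 ^ n * (1 / 4) ^ Suc n"
          using ykn[OF that] by (simp add: v_def p_scale norm_power)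
        also have "\<dots> = (1 / 2) ^ n * (1 / 4)" by (simp flip: power_mult_distrib)
        also have "\<dots> \<le> 1" using power_le_one[of "1 / 2 :: real" n] by simp
        finally show ?thesis .
      qed
      have "p k (v n) \<le> 1 + (\<Sum>i<k. p k (v i))" for n
      proof (cases "k \<le> n")
        case True
        then show ?thesis using vn sum_nonneg[of "{..<k}" "\<lambda>i. p k (v i)"] by fastforce
      next
        case False
        then show ?thesis using member_le_sum[of n "{..<k}" "\<lambda>i. p k (v i)"] by simp
      qed
      then show "\<exists>C. \<forall>x\<in>range v. p k x \<le> C" by blast
    qed
    show "(\<lambda>n. smul (l n * f n x) (v n)) sums K x" for x
    proof -
      have "l n * of_real (2 ^ n) = 1" for n
        unfolding l_def of_real_mult[symmetric] power_mult_distrib[symmetric] by simp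
      then have "l n * f n x * of_real (2 ^ n) = f n x" for n
        by (metis mult.assoc mult.commute mult_1_left)
      then have "smul (l n * f n x) (v n) = smul (f n x) (y n)" for n
        by (simp only: v_def scale_scale)
      then show ?thesis using sums[of x] by simp
    qed
  qed
  ultimately show thesis using K0 sums that by blast
qed

lemma separating_functional_projection:
  assumes P: "p0_operator P" "range P \<subseteq> V" "\<And>x. x \<in> V \<Longrightarrow> P x = x" and z: "z \<notin> V"
  obtains g where "p0_functional g" "\<And>x. x \<in> V \<Longrightarrow> g x = 0" "g z \<noteq> 0"
proof -
  interpret P: Vector_Spaces.linear smul smul P using P by (simp add: p0_operator_def)
  have "seminorm smul (\<lambda>x. p 0 (x - P x))"
    unfolding seminorm_def
  proof (intro conjI allI)
    show "p 0 (smul c x - P (smul c x)) = norm c * p 0 (x - P x)" for c x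
      by (simp add: P.scale p_scale flip: scale_right_diff_distrib)
    show "p 0 (x + y - P (x + y)) \<le> p 0 (x - P x) + p 0 (y - P y)" for x y
      using p_add[of 0 "x - P x" "y - P y"] by (simp add: P.add add_diff_add)
  qed simp
  moreover have "p 0 (z - P z) \<noteq> 0" using p0_eq_0D[of "z - P z"] P(2) z by auto
  ultimately obtain f where f: "Vector_Spaces.linear smul (*) f"
    "\<And>x. norm (f x) \<le> 2 * p 0 (x - P x)" "f z \<noteq> 0"
    by (rule Hahn_Banach_seminorm[OF vector_space_axioms]) (rule that)
  interpret f: Vector_Spaces.linear smul "(*)" f by (rule f(1))
  obtain C where C: "C \<ge> 0" "\<And>x. p 0 (P x) \<le> C * p 0 x" using p0_operator_bound P(1) by blast
  define D where "D = 2 * (1 + C)"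
  have D: "D > 0" using C by (simp add: D_def)
  have fD: "norm (f x) \<le> D * p 0 x" for x
    using f(2)[of x] p_diff[of 0 x "P x"] C(2)[of x] by (simp add: D_def algebra_simps)
  define g where "g = (\<lambda>x. f x / of_real D)"
  have "p0_functional g"
    unfolding p0_functional_def
  proof (intro conjI allI)
    show "Vector_Spaces.linear smul (*) g"
      by (intro linearI' vector_space_field) (simp_all add: g_def f.add f.scale add_divide_distrib)
    show "norm (g x) \<le> p 0 x" for x
      using fD[of x] D by (simp add: g_def norm_divide field_simps)
  qed
  moreover have "g x = 0" if "x \<in> V" for x using f(2)[of x] P(3)[OF that] by (simp add: g_def)
  moreover have "g z \<noteq> 0" using f(3) D by (simp add: g_def)
  ultimately show thesis by (rule that)
qed

lemma finite_span_projection: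
  assumes "finite B"
  shows "\<exists>P. p0_operator P \<and> range P \<subseteq> span B \<and> (\<forall>x\<in>span B. P x = x)"
  using assms
proof induction
  case empty
  then show ?case by (intro exI[of _ "\<lambda>x. 0"]) (auto simp: p0_operator_zero)
next
  case (insert b B)
  then obtain P where P: "p0_operator P" "range P \<subseteq> span B" "\<And>x. x \<in> span B \<Longrightarrow> P x = x" by blast
  show ?case
  proof (cases "b \<in> span B")
    case True
    then have "span (insert b B) = span B" by (simp add: span_redundant)
    then show ?thesis using P by auto
  next
    case False
    then obtain g where g: "p0_functional g" "\<And>x. x \<in> span B \<Longrightarrow> g x = 0" "g b \<noteq> 0"
      using separating_functional_projection[OF P] by metis
    define w where "w = smul (inverse (g b)) (b - P b)"
    define Q where "Q = (\<lambda>x. P x + smul (g x) w)"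
    have Q: "p0_operator Q"
      unfolding Q_def by (intro p0_operator_add P(1) p0_operator_rank_one g)
    interpret Q: Vector_Spaces.linear smul smul Q using Q by (simp add: p0_operator_def)
    have bP: "P x \<in> span (insert b B)" for x using P(2) span_mono[of B "insert b B"] by auto
    have "Q x \<in> span (insert b B)" for x
      unfolding Q_def w_def by (intro span_add span_scale span_diff bP span_base) simp
    then have "range Q \<subseteq> span (insert b B)" by blast
    moreover have "Q x = x" if "x \<in> span (insert b B)" for x
      using that
    proof (induction rule: span_induct_alt)
      case (step c z y)
      have "Q z = z"
      proof (cases "z = b")
        case True
        then show ?thesis using g(3) by (simp add: Q_def w_def)
      next
        case False
        then have z: "z \<in> span B" using step.hyps by (auto intro: span_base)
        then show ?thesis using g(2) P(3) by (simp add: Q_def)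
      qed
      then show ?case using step.IH by (simp add: Q.add Q.scale)
    qed simp
    ultimately show ?thesis using Q by blast
  qed
qed

lemma separating_functional:
  assumes "finite B" "z \<notin> span B"
  obtains f where "p0_functional f" "\<And>x. x \<in> span B \<Longrightarrow> f x = 0" "f z \<noteq> 0"
proof -
  obtain P where "p0_operator P" "range P \<subseteq> span B" "\<And>x. x \<in> span B \<Longrightarrow> P x = x"
    using finite_span_projection[OF assms(1)] by blast
  from separating_functional_projection[OF this assms(2)] that show thesis by blast
qed

end

section \<open>Isomorphisms between dense countably spanned subspaces\<close>

context normed_frechet
begin

lemma dense_p_approx:
  assumes "closure S = UNIV" "e > 0"
  obtains y where "y \<in> S" "p n (y - x) < e"
  using assms unfolding dense_p_iff by blast

lemma p_inverse_scale_le: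
  assumes "c \<noteq> 0" "p n x \<le> \<eta> * norm c"
  shows "p n (smul (inverse c) x) \<le> \<eta>"
  using assms by (simp add: p_scale norm_inverse divide_inverse[symmetric] mult.commute[of "inverse _"] pos_divide_le_eq)

lemma extend_forth:
  assumes B: "finite B" "B \<subseteq> E" "\<And>b. b \<in> B \<Longrightarrow> b + K b \<in> F"
    and F: "closure F = UNIV" and z: "z \<in> E" and \<eta>: "\<eta> > 0"
  obtains C f y where "p0_functional f" "\<And>b. b \<in> B \<Longrightarrow> f b = 0" "p m y \<le> \<eta>"
    "finite C" "B \<subseteq> C" "C \<subseteq> E" "\<And>b. b \<in> C \<Longrightarrow> b + (K b + smul (f b) y) \<in> F" "z \<in> span C"
proof (cases "z \<in> span B")
  case True
  show thesis by (rule that[of "\<lambda>x. 0" 0 B]) (use True B p0_functional_zero \<eta> in auto)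
next
  case False
  obtain f where f: "p0_functional f" "\<And>x. x \<in> span B \<Longrightarrow> f x = 0" "f z \<noteq> 0"
    using separating_functional[OF B(1) False] by blast
  obtain h where h: "h \<in> F" "p m (h - (z + K z)) < \<eta> * norm (f z)"
    using dense_p_approx[OF F, of "\<eta> * norm (f z)"] \<eta> f(3) by auto
  define y where "y = smul (inverse (f z)) (h - (z + K z))"
  have fB: "f b = 0" if "b \<in> B" for b using f(2) that span_base by blast
  show thesis
  proof (rule that[of f y "insert z B"])
    show "p m y \<le> \<eta>" unfolding y_def using h(2) f(3) by (intro p_inverse_scale_le) auto
    show "b + (K b + smul (f b) y) \<in> F" if "b \<in> insert z B" for b
    proof (cases "b = z")
      case True
      then show ?thesis using f(3) h(1) by (simp add: y_def)
    next
      case False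
      then show ?thesis using that B(3) fB by simp
    qed
  qed (use f fB B z span_base in auto)
qed

lemma extend_back:
  assumes B: "finite B" "B \<subseteq> E" "\<And>b. b \<in> B \<Longrightarrow> b + K b \<in> F"
    and E: "closure E = UNIV" and w: "w \<in> F" and \<eta>: "\<eta> > 0"
    and K: "p0_operator K" "\<And>x. p 0 (K x) \<le> 1 / 2 * p 0 x"
  obtains C f y where "p0_functional f" "\<And>b. b \<in> B \<Longrightarrow> f b = 0" "p m y \<le> \<eta>"
    "finite C" "B \<subseteq> C" "C \<subseteq> E" "\<And>b. b \<in> C \<Longrightarrow> b + (K b + smul (f b) y) \<in> F"
    "\<exists>z\<in>span C. z + (K z + smul (f z) y) = w"
proof -
  interpret K: Vector_Spaces.linear smul smul K using K by (simp add: p0_operator_def)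
  obtain u where u: "u + K u = w" using id_plus_contraction_surj[OF K] by blast
  show thesis
  proof (cases "u \<in> span B")
    case True
    show thesis by (rule that[of "\<lambda>x. 0" 0 B]) (use True B p0_functional_zero \<eta> u in auto)
  next
    case False
    obtain f where f: "p0_functional f" "\<And>x. x \<in> span B \<Longrightarrow> f x = 0" "f u \<noteq> 0"
      using separating_functional[OF B(1) False] by blast
    interpret f: Vector_Spaces.linear smul "(*)" f using f by (simp add: p0_functional_def)
    obtain D where D: "D \<ge> 0" "\<And>x. p m (K x) \<le> D * p 0 x" using p0_operator_bound K(1) by blast
    define \<delta> where "\<delta> = min (norm (f u) / 2) (\<eta> * (norm (f u) / 2) / (1 + D))"
    have \<delta>: "\<delta> > 0" using f(3) \<eta> D by (simp add: \<delta>_def)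
    obtain z where z: "z \<in> E" "p m (z - u) < \<delta>" using dense_p_approx[OF E \<delta>] by blast
    have z0: "p 0 (u - z) \<le> p m (u - z)" "p m (u - z) < \<delta>"
      using p_mono[of 0 m "u - z"] z(2) p_commute[of m u z] by simp_all
    have "norm (f u - f z) \<le> p 0 (u - z)"
      using f(1) by (auto simp: p0_functional_def simp flip: f.diff)
    also have "\<dots> < norm (f u) / 2" using z0 by (simp add: \<delta>_def)
    finally have fz: "norm (f z) > norm (f u) / 2" using norm_triangle_ineq2[of "f u" "f z"] by linarith
    then have fz0: "f z \<noteq> 0" by auto
    define y where "y = smul (inverse (f z)) (w - (z + K z))"
    have fB: "f b = 0" if "b \<in> B" for b using f(2) that span_base by blast
    have hit: "z + (K z + smul (f z) y) = w" using fz0 by (simp add: y_def)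
    show thesis
    proof (rule that[of f y "insert z B"])
      have "w - (z + K z) = (u - z) + K (u - z)" using u by (simp add: K.diff algebra_simps)
      then have "p m (w - (z + K z)) \<le> p m (u - z) + p m (K (u - z))"
        using p_add[of m "u - z" "K (u - z)"] by (simp only:)
      also have "\<dots> \<le> p m (u - z) + D * p m (u - z)"
        using D(2)[of "u - z"] mult_left_mono[OF z0(1) D(1)] by linarith
      also have "\<dots> = (1 + D) * p m (u - z)" by (simp add: algebra_simps)
      also have "\<dots> \<le> (1 + D) * \<delta>" using z0(2) D(1) by (intro mult_left_mono) auto
      also have "\<dots> \<le> (1 + D) * (\<eta> * (norm (f u) / 2) / (1 + D))"
        using D(1) by (intro mult_left_mono) (auto simp: \<delta>_def)
      also have "\<dots> = \<eta> * (norm (f u) / 2)"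
        by (subst times_divide_eq_right, rule nonzero_mult_div_cancel_left) (use D(1) in simp)
      also have "\<dots> \<le> \<eta> * norm (f z)" using fz \<eta> by (intro mult_left_mono) auto
      finally show "p m y \<le> \<eta>" unfolding y_def by (intro p_inverse_scale_le fz0)
      show "b + (K b + smul (f b) y) \<in> F" if "b \<in> insert z B" for b
        using that B(3) fB hit w by (cases "b = z") auto
      show "\<exists>z'\<in>span (insert z B). z' + (K z' + smul (f z') y) = w"
        using hit span_base by blast
    qed (use f fB B z in auto)
  qed
qed

lemma dense_subspace_isomorphism:
  fixes e g :: "nat \<Rightarrow> 'a"
  assumes E: "closure (span (range e)) = UNIV" and F: "closure (span (range g)) = UNIV"
    and x: "x \<in> span (range e)" and a: "a \<in> span (range g)"
    and f0: "p0_functional f0" "f0 x \<noteq> 0" "p 0 (a - x) \<le> 1 / 4 * norm (f0 x)"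
  obtains K where "p0_operator K" "\<And>z. p 0 (K z) \<le> 1 / 2 * p 0 z" "x + K x = a"
    "(\<lambda>z. z + K z) ` span (range e) = span (range g)"
proof -
  define \<Phi> where "\<Phi> = (\<lambda>n (B, K, f, y). finite B \<and> B \<subseteq> span (range e) \<and> p0_operator K \<and>
    (\<forall>z. p 0 (K z) \<le> (1 / 2 - (1 / 4) ^ Suc n) * p 0 z) \<and>
    (\<forall>b\<in>B. b + K b \<in> span (range g)) \<and> p0_functional f \<and> p n y \<le> (1 / 4) ^ Suc n \<and>
    (n = 0 \<longrightarrow> x \<in> B \<and> x + K x = a \<and> K = (\<lambda>z. smul (f z) y)))"
  define \<Psi> where "\<Psi> = (\<lambda>n (B, K, f :: 'a \<Rightarrow> 'k, y :: 'a) (C, L, h, w). B \<subseteq> C \<and> (\<forall>b\<in>B. h b = 0) \<and>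
    L = (\<lambda>z. K z + smul (h z) w) \<and>
    (if even n then e (n div 2) \<in> span C else (\<exists>z\<in>span C. z + L z = g (n div 2))))"
  have "\<exists>\<sigma>. \<forall>n. \<Phi> n (\<sigma> n) \<and> \<Psi> n (\<sigma> n) (\<sigma> (Suc n))"
  proof (rule dependent_nat_choice)
    define y where "y = smul (inverse (f0 x)) (a - x)"
    have y: "p 0 y \<le> 1 / 4" unfolding y_def using f0(2,3) by (intro p_inverse_scale_le)
    have hit: "x + smul (f0 x) y = a" using f0(2) by (simp add: y_def)
    have "p 0 (smul (f0 z) y) \<le> 1 / 4 * p 0 z" for z
    proof -
      have "norm (f0 z) * p 0 y \<le> p 0 z * (1 / 4)"
        using f0(1) y by (intro mult_mono) (auto simp: p0_functional_def)
      then show ?thesis by (simp add: p_scale)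
    qed
    then have "\<Phi> 0 ({x}, \<lambda>z. smul (f0 z) y, f0, y)"
      using x a y hit f0(1) p0_operator_rank_one[OF f0(1)] by (simp add: \<Phi>_def)
    then show "\<exists>s. \<Phi> 0 s" by blast
  next
    fix s n assume s: "\<Phi> n s"
    obtain B K f y where [simp]: "s = (B, K, f, y)" by (cases s)
    have B: "finite B" "B \<subseteq> span (range e)" "\<And>b. b \<in> B \<Longrightarrow> b + K b \<in> span (range g)"
      and K: "p0_operator K" "\<And>z. p 0 (K z) \<le> (1 / 2 - (1 / 4) ^ Suc n) * p 0 z"
      using s by (auto simp: \<Phi>_def)
    have half: "p 0 (K z) \<le> 1 / 2 * p 0 z" for z
      by (rule order_trans[OF K(2)]) (intro mult_right_mono, auto)
    define \<eta> :: real where "\<eta> = (1 / 4) ^ Suc (Suc n)"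
    have \<eta>: "\<eta> > 0" by (simp add: \<eta>_def)
    have "\<exists>C h w. p0_functional h \<and> (\<forall>b\<in>B. h b = 0) \<and> p (Suc n) w \<le> \<eta> \<and> finite C \<and>
      B \<subseteq> C \<and> C \<subseteq> span (range e) \<and> (\<forall>b\<in>C. b + (K b + smul (h b) w) \<in> span (range g)) \<and>
      (if even n then e (n div 2) \<in> span C else (\<exists>z\<in>span C. z + (K z + smul (h z) w) = g (n div 2)))"
    proof (cases "even n")
      case True
      have ez: "e (n div 2) \<in> span (range e)" by (simp add: span_base)
      obtain C h w where "p0_functional h" "\<And>b. b \<in> B \<Longrightarrow> h b = 0" "p (Suc n) w \<le> \<eta>"
        "finite C" "B \<subseteq> C" "C \<subseteq> span (range e)"
        "\<And>b. b \<in> C \<Longrightarrow> b + (K b + smul (h b) w) \<in> span (range g)" "e (n div 2) \<in> span C"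
        by (rule extend_forth[OF B F ez \<eta>, where m = "Suc n"]) blast+
      with True show ?thesis by (intro exI[of _ C] exI[of _ h] exI[of _ w]) auto
    next
      case False
      have gz: "g (n div 2) \<in> span (range g)" by (simp add: span_base)
      obtain C h w where "p0_functional h" "\<And>b. b \<in> B \<Longrightarrow> h b = 0" "p (Suc n) w \<le> \<eta>"
        "finite C" "B \<subseteq> C" "C \<subseteq> span (range e)"
        "\<And>b. b \<in> C \<Longrightarrow> b + (K b + smul (h b) w) \<in> span (range g)"
        "\<exists>z\<in>span C. z + (K z + smul (h z) w) = g (n div 2)"
        by (rule extend_back[OF B E gz \<eta> K(1) half, where m = "Suc n"]) blast+
      with False show ?thesis by (intro exI[of _ C] exI[of _ h] exI[of _ w]) auto
    qed
    then obtain C h w where h: "p0_functional h" "\<forall>b\<in>B. h b = 0" "p (Suc n) w \<le> \<eta>"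
      and C: "finite C" "B \<subseteq> C" "C \<subseteq> span (range e)"
        "\<forall>b\<in>C. b + (K b + smul (h b) w) \<in> span (range g)"
      and goal: "if even n then e (n div 2) \<in> span C
        else (\<exists>z\<in>span C. z + (K z + smul (h z) w) = g (n div 2))"
      by blast
    have "p 0 (K z + smul (h z) w) \<le> (1 / 2 - \<eta>) * p 0 z" for z
    proof -
      have "p 0 (smul (h z) w) \<le> p 0 z * \<eta>"
        using h p_mono[of 0 "Suc n" w] unfolding p_scale
        by (intro mult_mono) (auto simp: p0_functional_def)
      then have "p 0 (K z + smul (h z) w) \<le> (1 / 2 - 4 * \<eta>) * p 0 z + p 0 z * \<eta>"
        using K(2)[of z] p_add[of 0 "K z" "smul (h z) w"] by (simp add: \<eta>_def)
      also have "\<dots> \<le> (1 / 2 - \<eta>) * p 0 z" using \<eta> by (simp add: algebra_simps)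
      finally show ?thesis .
    qed
    then have "\<Phi> (Suc n) (C, \<lambda>z. K z + smul (h z) w, h, w)"
      using C h p0_operator_add[OF K(1) p0_operator_rank_one[OF h(1)], of w]
      by (simp add: \<Phi>_def \<eta>_def)
    moreover have "\<Psi> n s (C, \<lambda>z. K z + smul (h z) w, h, w)"
      using C h goal by (simp add: \<Psi>_def)
    ultimately show "\<exists>t. \<Phi> (Suc n) t \<and> \<Psi> n s t" by blast
  qed
  then obtain \<sigma> where \<sigma>: "\<And>n. \<Phi> n (\<sigma> n)" "\<And>n. \<Psi> n (\<sigma> n) (\<sigma> (Suc n))" by blast
  define B where "B = (\<lambda>n. fst (\<sigma> n))"
  define L where "L = (\<lambda>n. fst (snd (\<sigma> n)))"
  define f where "f = (\<lambda>n. fst (snd (snd (\<sigma> n))))"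
  define y where "y = (\<lambda>n. snd (snd (snd (\<sigma> n))))"
  have \<sigma>_eq: "\<sigma> n = (B n, L n, f n, y n)" for n by (simp add: B_def L_def f_def y_def)
  note facts = \<sigma>[unfolded \<sigma>_eq \<Phi>_def \<Psi>_def prod.case]
  have f: "p0_functional (f n)" and y: "p n (y n) \<le> (1 / 4) ^ Suc n"
    and BE: "B n \<subseteq> span (range e)" and BF: "b \<in> B n \<Longrightarrow> b + L n b \<in> span (range g)"
    and BS: "B n \<subseteq> B (Suc n)" and fB: "b \<in> B n \<Longrightarrow> f (Suc n) b = 0"
    and LS: "L (Suc n) = (\<lambda>z. L n z + smul (f (Suc n) z) (y (Suc n)))"
    and L0: "L 0 = (\<lambda>z. smul (f 0 z) (y 0))" and x0: "x \<in> B 0" "x + L 0 x = a"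
    and steps: "if even n then e (n div 2) \<in> span (B (Suc n))
      else \<exists>z\<in>span (B (Suc n)). z + L (Suc n) z = g (n div 2)" for n b
    using facts(1)[of n] facts(2)[of n] facts(1)[of 0] by blast+
  have L: "p0_operator (L n)" for n using facts(1)[of n] by simp
  have Lsum: "L n z = (\<Sum>i\<le>n. smul (f i z) (y i))" for n z
    by (induction n) (simp_all add: L0 LS)
  obtain K where K: "p0_operator K" "\<And>z. p 0 (K z) \<le> 1 / 2 * p 0 z"
    "\<And>z. (\<lambda>n. smul (f n z) (y n)) sums K z"
    by (rule rank_one_series[of f y, OF f y]) (rule that)
  interpret K: Vector_Spaces.linear smul smul K using K(1) by (simp add: p0_operator_def)
  have Bmono: "B m \<subseteq> B n" if "m \<le> n" for m n using BS that by (rule lift_Suc_mono_le)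
  have KB: "K b = L n b" if "b \<in> B n" for n b
  proof -
    have "f i b = 0" if i: "i \<notin> {..n}" for i
    proof -
      obtain j where "i = Suc j" "n \<le> j" using i by (cases i) auto
      then show ?thesis using fB[of b j] Bmono[of n j] \<open>b \<in> B n\<close> by auto
    qed
    then have "(\<lambda>i. smul (f i b) (y i)) sums (\<Sum>i\<le>n. smul (f i b) (y i))"
      by (intro sums_finite) auto
    then show ?thesis using K(3)[of b] LIMSEQ_p_unique unfolding sums_def Lsum by blast
  qed
  have KspanB: "K z = L n z" if "z \<in> span (B n)" for n z
  proof -
    interpret Ln: Vector_Spaces.linear smul smul "L n" using L by (simp add: p0_operator_def)
    show ?thesis using that
      by (induction rule: span_induct_alt) (simp_all add: K.add K.scale Ln.add Ln.scale KB)
  qed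
  define J where "J = (\<lambda>z. z + K z)"
  interpret J: Vector_Spaces.linear smul smul J
    using continuous_linear_id_plus[OF K(1)] by (simp add: continuous_linear_def J_def)
  define U where "U = (\<Union>n. B n)"
  have "range e \<subseteq> span U"
  proof clarify
    fix k show "e k \<in> span U"
      using steps[of "2 * k"] span_mono[of "B (Suc (2 * k))" U] by (auto simp: U_def)
  qed
  moreover have "U \<subseteq> span (range e)" using BE by (auto simp: U_def)
  ultimately have spanU: "span U = span (range e)"
    by (metis span_minimal subspace_span subset_antisym)
  have "J ` span U = span (range g)"
  proof
    have "J ` U \<subseteq> span (range g)" using BF KB by (auto simp: U_def J_def)
    then show "J ` span U \<subseteq> span (range g)"
      by (metis J.span_image span_minimal subspace_span)
    have "g k \<in> J ` span U" for k
    proof -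
      obtain z where z: "z \<in> span (B (Suc (2 * k + 1)))" "z + L (Suc (2 * k + 1)) z = g k"
        using steps[of "2 * k + 1"] by auto
      then have "g k = J z" using KspanB[OF z(1)] by (simp only: J_def)
      moreover have "z \<in> span U" using z(1) span_mono[of "B (Suc (2 * k + 1))" U] by (auto simp: U_def)
      ultimately show ?thesis by (rule image_eqI)
    qed
    then show "span (range g) \<subseteq> J ` span U"
      by (intro span_minimal J.subspace_image subspace_span) auto
  qed
  moreover have "x + K x = a" using x0 KB by metis
  ultimately show thesis using K that unfolding spanU J_def by blast
qed

end

section \<open>Hypercyclic nuclear perturbations of the identity\<close>

context normed_frechet
begin

lemma biorthogonal_sequence:
  fixes b :: "nat \<Rightarrow> 'a"
  assumes b: "\<And>n. b n \<notin> span (b ` {..<n})"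
  obtains x :: "nat \<Rightarrow> 'a" and f :: "nat \<Rightarrow> 'a \<Rightarrow> 'k" where "\<And>n. p0_functional (f n)" "\<And>n. f n (x n) = 1" "\<And>m n. m \<noteq> n \<Longrightarrow> f m (x n) = 0"
    "span (range x) = span (range b)"
proof -
  define \<Phi> where "\<Phi> = (\<lambda>h n (x, f). x \<in> span (b ` {..n}) \<and> b n \<in> span (insert x (b ` {..<n})) \<and>
    p0_functional f \<and> f x = 1 \<and> (\<forall>v\<in>span (b ` {..<n}). f v = 0) \<and>
    (\<forall>i<n. snd (h i :: 'a \<times> ('a \<Rightarrow> 'k)) x = 0))"
  have "\<exists>h. \<forall>n. \<Phi> h n (h n)"
  proof (rule dependent_wellorder_choice)
    show "\<Phi> h n r = \<Phi> g n r" if "\<And>m. m < n \<Longrightarrow> h m = g m" for h g n r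
      using that by (auto simp: \<Phi>_def)
    fix n h assume IH: "\<And>m. m < n \<Longrightarrow> \<Phi> h m (h m)"
    define X where "X = (\<lambda>i. fst (h i))"
    define F where "F = (\<lambda>i. snd (h i))"
    have h: "h i = (X i, F i)" for i by (simp add: X_def F_def)
    have IH': "X m \<in> span (b ` {..m})" "p0_functional (F m)" "F m (X m) = 1"
      "\<forall>v\<in>span (b ` {..<m}). F m v = 0" "\<forall>i<m. F i (X m) = 0" if "m < n" for m
      using IH[OF that, unfolded h \<Phi>_def] by auto
    have Xn: "X m \<in> span (b ` {..<n})" if "m < n" for m
    proof -
      have "b ` {..m} \<subseteq> b ` {..<n}" using that by auto
      then show ?thesis using IH'(1)[OF that] span_mono by blast
    qed
    have FX: "F j (X i) = (if i = j then 1 else 0)" if "i < n" "j < n" for i j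
    proof -
      consider "i < j" | "i = j" | "j < i" by linarith
      then show ?thesis
      proof cases
        case 1
        then have "b ` {..i} \<subseteq> b ` {..<j}" by auto
        then have "X i \<in> span (b ` {..<j})" using IH'(1)[OF that(1)] span_mono by blast
        then show ?thesis using IH'(4)[OF that(2)] 1 by simp
      qed (use IH' that in auto)
    qed
    define s where "s = (\<Sum>i<n. smul (F i (b n)) (X i))"
    have s: "s \<in> span (b ` {..<n})" unfolding s_def by (intro span_sum span_scale Xn) simp
    define z where "z = b n - s"
    have z: "z \<notin> span (b ` {..<n})"
    proof
      assume "z \<in> span (b ` {..<n})"
      then have "z + s \<in> span (b ` {..<n})" using s by (rule span_add)
      then show False using b[of n] by (simp add: z_def)
    qed
    obtain f where f: "p0_functional f" "\<And>v. v \<in> span (b ` {..<n}) \<Longrightarrow> f v = 0" "f z \<noteq> 0"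
      using separating_functional[OF _ z] by blast
    interpret f: Vector_Spaces.linear smul "(*)" f using f by (simp add: p0_functional_def)
    define x where "x = smul (inverse (f z)) z"
    have "\<Phi> h n (x, f)"
      unfolding \<Phi>_def prod.case
    proof (intro conjI allI impI ballI)
      have "b ` {..<n} \<subseteq> b ` {..n}" by auto
      then have "s \<in> span (b ` {..n})" using s span_mono by blast
      then show "x \<in> span (b ` {..n})"
        unfolding x_def z_def by (intro span_scale span_diff) (auto intro: span_base)
      have "s \<in> span (insert x (b ` {..<n}))" using s span_mono[of "b ` {..<n}"] by blast
      then have "smul (f z) x + s \<in> span (insert x (b ` {..<n}))"
        by (intro span_add span_scale) (auto intro: span_base)
      moreover have "smul (f z) x + s = b n" using f(3) by (simp add: x_def z_def)
      ultimately show "b n \<in> span (insert x (b ` {..<n}))" by simp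
      show "f x = 1" using f(3) by (simp add: x_def f.scale)
      fix j assume j: "j < n"
      interpret Fj: Vector_Spaces.linear smul "(*)" "F j" using IH'(2)[OF j] by (simp add: p0_functional_def)
      have "F j s = (\<Sum>i<n. F i (b n) * F j (X i))" by (simp add: s_def Fj.sum Fj.scale)
      also have "\<dots> = (\<Sum>i<n. if i = j then F i (b n) else 0)" by (intro sum.cong) (auto simp: FX j)
      also have "\<dots> = F j (b n)" using j by (simp add: sum.delta')
      finally have "F j x = 0" by (simp add: x_def z_def Fj.scale Fj.diff)
      then show "snd (h j) x = 0" by (simp add: F_def)
    qed (use f in auto)
    then show "\<exists>r. \<Phi> h n r" by blast
  qed
  then obtain h where h: "\<And>n. \<Phi> h n (h n)" by blast
  define x where "x = (\<lambda>i. fst (h i))"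
  define f where "f = (\<lambda>i. snd (h i))"
  have h_eq: "h i = (x i, f i)" for i by (simp add: x_def f_def)
  have xf: "x n \<in> span (b ` {..n})" "b n \<in> span (insert (x n) (b ` {..<n}))" "p0_functional (f n)"
      "f n (x n) = 1" "v \<in> span (b ` {..<n}) \<Longrightarrow> f n v = 0" "i < n \<Longrightarrow> f i (x n) = 0" for n i v
    using h[of n, unfolded h_eq \<Phi>_def] h_eq by auto
  show thesis
  proof (rule that[of f x])
    show "f m (x n) = 0" if "m \<noteq> n" for m n
    proof (cases "m < n")
      case False
      then have "b ` {..n} \<subseteq> b ` {..<m}" using that by auto
      then show ?thesis using xf(1)[of n] span_mono xf(5)[of "x n" m] by blast
    qed (rule xf(6))
    have "b n \<in> span (range x)" for n
    proof (induction n rule: less_induct)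
      case (less n)
      then have "insert (x n) (b ` {..<n}) \<subseteq> span (range x)" by (auto intro: span_base)
      then show ?case using xf(2)[of n] span_minimal[OF _ subspace_span] by blast
    qed
    moreover have "x n \<in> span (range b)" for n using xf(1)[of n] span_mono[of "b ` {..n}" "range b"] by auto
    ultimately show "span (range x) = span (range b)"
      by (intro subset_antisym span_minimal subspace_span) auto
  qed (use xf in auto)
qed

lemma exists_binomial_shift:
  fixes b :: "nat \<Rightarrow> 'a"
  assumes b: "\<And>n. b n \<notin> span (b ` {..<n})"
  obtains \<xi> :: "nat \<Rightarrow> 'a" and K where "span (range \<xi>) = span (range b)" "p0_operator K" "nuclear smul K"
    "\<And>j. K (\<xi> j) = (\<Sum>i<j. smul (of_nat (j choose i)) (\<xi> i))"
proof -
  obtain x :: "nat \<Rightarrow> 'a" and f :: "nat \<Rightarrow> 'a \<Rightarrow> 'k" where f: "\<And>n. p0_functional (f n)" and fx: "\<And>n. f n (x n) = 1"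
    and fx0: "\<And>m n. m \<noteq> n \<Longrightarrow> f m (x n) = 0" and span_x: "span (range x) = span (range b)"
    by (rule biorthogonal_sequence[of b, OF b]) (rule that)
  have "\<exists>c :: nat \<Rightarrow> real. \<forall>j. 0 < c j \<and> (\<Sum>i<j. 4 ^ Suc j * real (j choose i) * p j (x i) * c i) \<le> c j"
  proof (rule dependent_wellorder_choice)
    show "\<exists>r > 0. (\<Sum>i<j. 4 ^ Suc j * real (j choose i) * p j (x i) * c i) \<le> r" for j and c :: "nat \<Rightarrow> real"
      by (intro exI[of _ "\<bar>\<Sum>i<j. 4 ^ Suc j * real (j choose i) * p j (x i) * c i\<bar> + 1"]) linarith
  qed auto
  then obtain c :: "nat \<Rightarrow> real" where c: "\<And>j. 0 < c j"
      "\<And>j. (\<Sum>i<j. 4 ^ Suc j * real (j choose i) * p j (x i) * c i) \<le> c j"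
    by blast
  define \<xi> where "\<xi> = (\<lambda>j. smul (of_real (c j)) (x j))"
  define \<eta> where "\<eta> = (\<lambda>j. \<Sum>i<j. smul (of_nat (j choose i)) (\<xi> i))"
  define y where "y = (\<lambda>j. smul (of_real (inverse (c j))) (\<eta> j))"
  have y: "p j (y j) \<le> (1 / 4) ^ Suc j" for j
  proof -
    have "4 ^ Suc j * p j (\<eta> j) \<le> 4 ^ Suc j * (\<Sum>i<j. p j (smul (of_nat (j choose i)) (\<xi> i)))"
      unfolding \<eta>_def by (intro mult_left_mono p_sum) simp
    also have "\<dots> = (\<Sum>i<j. 4 ^ Suc j * real (j choose i) * p j (x i) * c i)"
      using less_imp_le[OF c(1)] by (simp add: \<xi>_def p_scale norm_mult sum_distrib_left ac_simps)
    also have "\<dots> \<le> c j" by (rule c(2))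
    finally have "p j (\<eta> j) / c j \<le> 1 / 4 ^ Suc j"
      using c(1)[of j] by (simp add: field_simps)
    moreover have "p j (y j) = p j (\<eta> j) / c j"
      using c(1)[of j] unfolding y_def p_scale norm_of_real by (simp add: divide_inverse)
    ultimately show ?thesis by (simp only: power_one_over)
  qed
  obtain K where K: "p0_operator K" "nuclear smul K" "\<And>x. (\<lambda>n. smul (f n x) (y n)) sums K x"
    by (rule rank_one_series[of f y, OF f y]) (rule that)
  have "K (\<xi> j) = \<eta> j" for j
  proof -
    have f\<xi>: "f n (\<xi> j) = of_real (c j) * f n (x j)" for n
      using f[of n] by (simp add: \<xi>_def p0_functional_def Vector_Spaces.linear_iff)
    have "(\<lambda>n. smul (f n (\<xi> j)) (y n)) sums (\<Sum>n\<in>{j}. smul (f n (\<xi> j)) (y n))"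
      by (rule sums_finite) (auto simp: f\<xi> fx0)
    then have "K (\<xi> j) = smul (f j (\<xi> j)) (y j)"
      using K(3)[of "\<xi> j"] LIMSEQ_p_unique unfolding sums_def by simp
    also have "\<dots> = smul (of_real (c j * inverse (c j))) (\<eta> j)" by (simp add: f\<xi> fx y_def)
    also have "\<dots> = \<eta> j" using c(1)[of j] by simp
    finally show ?thesis .
  qed
  moreover have "span (range \<xi>) = span (range x)"
  proof (intro subset_antisym span_minimal subspace_span)
    show "range \<xi> \<subseteq> span (range x)" by (auto simp: \<xi>_def intro: span_scale span_base)
    have "x j \<in> span (range \<xi>)" for j
    proof -
      have "x j = smul (inverse (of_real (c j))) (\<xi> j)" using c(1)[of j] by (simp add: \<xi>_def)
      then show ?thesis by (metis span_base span_scale rangeI)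
    qed
    then show "range x \<subseteq> span (range \<xi>)" by auto
  qed
  ultimately show thesis using that[of \<xi> K] K(1,2) span_x by (simp add: \<eta>_def)
qed

lemma Baire_p:
  fixes U :: "nat \<Rightarrow> 'a set"
  assumes op: "\<And>i. open (U i)" and dense: "\<And>i. closure (U i) = UNIV" and e: "e > 0"
  obtains x where "\<And>i::nat. x \<in> U i" "p n (x - y) < e"
proof -
  define B where "B = (\<lambda>(c, k, r). {x. p k (x - c) \<le> r})"
  define \<Psi> where "\<Psi> = (\<lambda>i s (c, k, r). i \<le> k \<and> r \<le> 1 / Suc i \<and> B (c, k, r) \<subseteq> U i \<inter> B s)"
  have "\<exists>\<sigma>. \<forall>i. (snd (snd (\<sigma> i)) > 0 \<and> (i = 0 \<longrightarrow> \<sigma> i = (y, n, e / 2))) \<and> \<Psi> i (\<sigma> i) (\<sigma> (Suc i))"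
  proof (rule dependent_nat_choice)
    show "\<exists>s. snd (snd s) > 0 \<and> (0 = (0::nat) \<longrightarrow> s = (y, n, e / 2))"
      using e by (intro exI[of _ "(y, n, e / 2)"]) simp
    fix s :: "'a \<times> nat \<times> real" and i :: nat
    assume s: "snd (snd s) > 0 \<and> (i = 0 \<longrightarrow> s = (y, n, e / 2))"
    obtain c k r where s_eq: "s = (c, k, r)" by (cases s)
    then have r: "r > 0" using s by simp
    obtain x where x: "x \<in> U i" "p k (x - c) < r" using dense_p_approx[OF dense r] by blast
    obtain l d where l: "d > 0" "{y. p l (y - x) < d} \<subseteq> U i" using op[of i] x(1) unfolding open_iff_p by blast
    define k' where "k' = max i (max k l)"
    define r' where "r' = min (d / 2) (min (r - p k (x - c)) (1 / Suc i))"
    have k': "i \<le> k'" "k \<le> k'" "l \<le> k'" by (auto simp: k'_def)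
    have r': "0 < r'" "r' < d" "r' \<le> r - p k (x - c)" "r' \<le> 1 / Suc i"
      using l(1) x(2) by (auto simp: r'_def)
    have "z \<in> U i \<and> p k (z - c) \<le> r" if z: "p k' (z - x) \<le> r'" for z
    proof
      have "p l (z - x) < d" using p_mono[OF k'(3), of "z - x"] z r'(2) by linarith
      then show "z \<in> U i" using l(2) by blast
      have "p k (z - x) \<le> r'" using p_mono[OF k'(2), of "z - x"] z by linarith
      then show "p k (z - c) \<le> r" using p_triangle[of k z c x] r'(3) by linarith
    qed
    then have "\<Psi> i s (x, k', r')" using k' r' by (auto simp: \<Psi>_def B_def s_eq)
    then show "\<exists>t. (snd (snd t) > 0 \<and> (Suc i = 0 \<longrightarrow> t = (y, n, e / 2))) \<and> \<Psi> i s t"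
      using r' by (intro exI[of _ "(x, k', r')"]) simp
  qed
  then obtain \<sigma> where \<sigma>: "\<And>i. snd (snd (\<sigma> i)) > 0" "\<sigma> 0 = (y, n, e / 2)" "\<And>i. \<Psi> i (\<sigma> i) (\<sigma> (Suc i))"
    by blast
  define c where "c = (\<lambda>i. fst (\<sigma> i))"
  define k where "k = (\<lambda>i. fst (snd (\<sigma> i)))"
  define r where "r = (\<lambda>i. snd (snd (\<sigma> i)))"
  have \<sigma>_eq: "\<sigma> i = (c i, k i, r i)" for i by (simp add: c_def k_def r_def)
  have r: "r i > 0" and k: "i \<le> k (Suc i)" and rS: "r (Suc i) \<le> 1 / Suc i"
    and BU: "B (\<sigma> (Suc i)) \<subseteq> U i" and BB: "B (\<sigma> (Suc i)) \<subseteq> B (\<sigma> i)" for i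
    using \<sigma>(1)[of i] \<sigma>(3)[of i] by (auto simp: \<Psi>_def \<sigma>_eq)
  have Bmono: "B (\<sigma> j) \<subseteq> B (\<sigma> i)" if "i \<le> j" for i j
    using BB that by (rule lift_Suc_antimono_le)
  have cB: "p (k i) (c j - c i) \<le> r i" if "i \<le> j" for i j
  proof -
    have "c j \<in> B (\<sigma> j)" using less_imp_le[OF r[of j]] by (simp add: B_def \<sigma>_eq)
    then have "c j \<in> B (\<sigma> i)" using Bmono[OF that] by blast
    then show ?thesis by (simp add: B_def \<sigma>_eq)
  qed
  have "\<exists>M. \<forall>i\<ge>M. \<forall>j\<ge>M. p m (c i - c j) < \<epsilon>" if \<epsilon>: "\<epsilon> > 0" for m \<epsilon>
  proof -
    obtain N where N: "1 / Suc N < \<epsilon> / 2" using nat_approx_posE[of "\<epsilon> / 2"] \<epsilon> by auto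
    define M where "M = max m N"
    have "1 / Suc M \<le> 1 / Suc N" by (simp add: M_def frac_le)
    then have M: "r (Suc M) < \<epsilon> / 2" "m \<le> k (Suc M)" using N rS[of M] k[of M] by (auto simp: M_def)
    have "p m (c i - c (Suc M)) < \<epsilon> / 2" if "Suc M \<le> i" for i
      using cB[OF that] p_mono[OF M(2), of "c i - c (Suc M)"] M(1) by linarith
    then have "p m (c i - c j) < \<epsilon>" if "Suc M \<le> i" "Suc M \<le> j" for i j
      using that p_triangle[of m "c i" "c j" "c (Suc M)"] p_commute[of m "c (Suc M)" "c j"]
      by (smt (verit) field_sum_of_halves)
    then show ?thesis by blast
  qed
  then obtain l where l: "c \<longlonglongrightarrow> l" by (rule Cauchy_p_convergent) blast+
  have lB: "l \<in> B (\<sigma> i)" for i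
  proof -
    have "(\<lambda>j. p (k i) (c j - l)) \<longlonglongrightarrow> 0" using l LIMSEQ_p_iff by blast
    from tendsto_add[OF this tendsto_const[of "r i"]]
    have "(\<lambda>j. p (k i) (c j - l) + r i) \<longlonglongrightarrow> r i" by simp
    moreover have "p (k i) (l - c i) \<le> p (k i) (c j - l) + r i" if "i \<le> j" for j
      using p_triangle[of "k i" l "c i" "c j"] cB[OF that] p_commute[of "k i" l "c j"] by linarith
    ultimately have "p (k i) (l - c i) \<le> r i" by (intro LIMSEQ_le_const) auto
    then show ?thesis by (simp add: B_def \<sigma>_eq)
  qed
  have "p n (l - y) < e" using lB[of 0] e \<sigma>(2) by (simp add: B_def)
  moreover have "l \<in> U i" for i :: nat using lB[of "Suc i"] BU[of i] by blast
  ultimately show thesis using that by blast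
qed

end

lemma pcompose_power: "pcompose (q ^ n) r = pcompose q r ^ n"
  for q r :: "'a::comm_semiring_1 poly"
  by (induction n) (simp_all add: pcompose_1 pcompose_mult)

lemma pcompose_monom: "pcompose (monom c n) q = smult c (q ^ n)"
  for q :: "'a::comm_semiring_1 poly"
  by (simp add: monom_altdef pcompose_smult pcompose_power pcompose_pCons)

lemma degree_linear_power_le: "degree ([:c, s:] ^ n) \<le> n"
  for c s :: "'a::comm_semiring_1"
proof -
  have "degree [:c, s:] * n \<le> 1 * n" by (intro mult_le_mono1) simp
  then show ?thesis using degree_power_le[of "[:c, s:]" n] by linarith
qed

lemma coeff_linear_power_tendsto:
  fixes s :: "nat \<Rightarrow> 'k::real_normed_field"
  assumes "s \<longlonglongrightarrow> 0"
  shows "(\<lambda>m. coeff ([:c, s m:] ^ n) i) \<longlonglongrightarrow> coeff ([:c:] ^ n) i"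
proof (cases "i \<le> n")
  case True
  have "(\<lambda>m. of_nat (n choose i) * s m ^ i * c ^ (n - i)) \<longlonglongrightarrow> of_nat (n choose i) * 0 ^ i * c ^ (n - i)"
    using assms by (intro tendsto_intros)
  then show ?thesis using coeff_linear_poly_power[OF True, of c 0] by (simp add: coeff_linear_poly_power True)
next
  case False
  then have "degree ([:c, t:] ^ n) < i" for t
    using degree_linear_power_le[of c t n] by linarith
  from this[of 0] this show ?thesis by (simp add: coeff_eq_0)
qed

text \<open>For small \<open>s\<close> the first polynomial is close to \<open>X\<^sup>j\<close> and the second one to 0, and the
  translations by \<open>- 1 / s\<close> and \<open>1 / s\<close> exchange them. This is the source of transitivity.\<close>

definition near_monom :: "nat \<Rightarrow> 'k::field \<Rightarrow> 'k poly" where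
  "near_monom j s = monom 1 j * [:1, s:] ^ Suc j"

definition near_zero :: "nat \<Rightarrow> 'k::field \<Rightarrow> 'k poly" where
  "near_zero j s = smult s (monom 1 (Suc j) * [:- 1, s:] ^ j)"

lemma translate_near_monom:
  assumes "s * t = - 1"
  shows "pcompose (near_monom j s) [:t, 1:] = near_zero j s"
proof -
  have "pcompose (near_monom j s) [:t, 1:] = [:t, 1:] ^ j * [:0, s:] ^ Suc j"
  proof -
    have "pcompose [:1, s:] [:t, 1:] = [:0, s:]"
      using assms by (simp add: pcompose_pCons mult.commute)
    then show ?thesis
      by (simp only: near_monom_def pcompose_mult pcompose_monom pcompose_power smult_1_left)
  qed
  also have "\<dots> = [:0, s:] * ([:t, 1:] * [:0, s:]) ^ j"
    by (simp only: power_mult_distrib power_Suc ac_simps)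
  also have "[:t, 1:] * [:0, s:] = [:0, 1:] * [:- 1, s:]" using assms by (simp add: mult.commute)
  also have "[:0, s:] * ([:0, 1:] * [:- 1, s:]) ^ j = smult s ([:0, 1:] * ([:0, 1:] * [:- 1, s:]) ^ j)"
    by simp
  finally show ?thesis by (simp only: near_zero_def monom_altdef smult_1_left power_mult_distrib power_Suc ac_simps)
qed

lemma translate_near_zero:
  assumes "s * t = 1"
  shows "pcompose (near_zero j s) [:t, 1:] = near_monom j s"
proof -
  have "pcompose (near_zero j s) [:t, 1:] = smult s ([:t, 1:] ^ Suc j * [:0, s:] ^ j)"
  proof -
    have "pcompose [:- 1, s:] [:t, 1:] = [:0, s:]"
      using assms by (simp add: pcompose_pCons mult.commute)
    then show ?thesis
      by (simp only: near_zero_def pcompose_mult pcompose_smult pcompose_monom pcompose_power smult_1_left)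
  qed
  also have "\<dots> = smult s [:t, 1:] * ([:t, 1:] * [:0, s:]) ^ j"
    by (simp only: power_mult_distrib power_Suc mult_smult_left ac_simps)
  also have "[:t, 1:] * [:0, s:] = [:0, 1:] * [:1, s:]" using assms by (simp add: mult.commute)
  also have "smult s [:t, 1:] = [:1, s:]" using assms by simp
  finally show ?thesis by (simp only: near_monom_def monom_altdef smult_1_left power_mult_distrib power_Suc ac_simps)
qed

locale binomial_shift = normed_frechet smul p
  for smul :: "'k::real_or_complex \<Rightarrow> 'a::{ab_group_add,topological_space} \<Rightarrow> 'a" and p +
  fixes \<xi> :: "nat \<Rightarrow> 'a" and K :: "'a \<Rightarrow> 'a"
  assumes K: "p0_operator K"
    and K_\<xi>: "K (\<xi> j) = (\<Sum>i<j. smul (of_nat (j choose i)) (\<xi> i))"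
    and dense_\<xi>: "closure (span (range \<xi>)) = UNIV"
begin

sublocale K: Vector_Spaces.linear smul smul K
  using K by (simp add: p0_operator_def)

definition T :: "'a \<Rightarrow> 'a" where "T x = x + K x"

lemma T_continuous_linear: "continuous_linear smul smul T"
  using continuous_linear_id_plus[OF K] by (simp add: T_def[abs_def])

sublocale T: Vector_Spaces.linear smul smul T
  using T_continuous_linear by (simp add: continuous_linear_def)

lemma T_continuous: "continuous_on UNIV T"
  using T_continuous_linear by (simp add: continuous_linear_def)

text \<open>Under \<open>X\<^sup>j \<mapsto> \<xi> j\<close>, the operator \<^term>\<open>T\<close> becomes the translation
  \<open>q(X) \<mapsto> q(X + 1)\<close> of polynomials.\<close>

definition vec :: "'k poly \<Rightarrow> 'a" where
  "vec q = (\<Sum>i\<le>degree q. smul (coeff q i) (\<xi> i))"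

lemma vec_altdef: "degree q \<le> n \<Longrightarrow> vec q = (\<Sum>i\<le>n. smul (coeff q i) (\<xi> i))"
  unfolding vec_def by (rule sum.mono_neutral_left) (auto simp: coeff_eq_0)

lemma vec_add: "vec (q + r) = vec q + vec r"
proof -
  define n where "n = max (degree q) (degree r)"
  have "degree q \<le> n" "degree r \<le> n" "degree (q + r) \<le> n"
    by (auto simp: n_def degree_add_le_max)
  then show ?thesis by (simp add: vec_altdef scale_left_distrib sum.distrib)
qed

lemma vec_smult: "vec (smult c q) = smul c (vec q)"
  by (simp add: vec_altdef[OF degree_smult_le] scale_sum_right vec_def)

lemma vec_0 [simp]: "vec 0 = 0"
  by (simp add: vec_def)

lemma vec_sum: "vec (sum f I) = (\<Sum>i\<in>I. vec (f i))"
  by (induction I rule: infinite_finite_induct) (simp_all add: vec_add)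

lemma vec_monom: "vec (monom 1 j) = \<xi> j"
proof -
  have "vec (monom 1 j) = (\<Sum>i\<le>j. smul (if i = j then 1 else 0) (\<xi> i))"
    by (simp add: vec_altdef[OF degree_monom_le] eq_commute)
  also have "\<dots> = (\<Sum>i\<le>j. if i = j then \<xi> i else 0)" by (intro sum.cong) auto
  finally show ?thesis by simp
qed

lemma range_vec: "range vec = span (range \<xi>)"
proof
  show "range vec \<subseteq> span (range \<xi>)"
    by (auto simp: vec_def intro!: span_sum span_scale intro: span_base)
  show "span (range \<xi>) \<subseteq> range vec"
  proof (rule span_minimal)
    show "range \<xi> \<subseteq> range vec"
    proof (rule image_subsetI)
      show "\<xi> j \<in> range vec" for j using rangeI[of vec "monom 1 j"] by (simp only: vec_monom)
    qed
    show "subspace (range vec)"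
    proof (rule subspaceI)
      show "0 \<in> range vec" by (rule range_eqI[of _ _ 0]) simp
      show "x + y \<in> range vec" if "x \<in> range vec" "y \<in> range vec" for x y
        using that by (auto simp flip: vec_add)
      show "smul c x \<in> range vec" if "x \<in> range vec" for c x
        using that by (auto simp flip: vec_smult)
    qed
  qed
qed

lemma T_\<xi>: "T (\<xi> j) = vec ([:1, 1:] ^ j)"
proof -
  have "degree ([:1, 1:] ^ j :: 'k poly) \<le> j" using degree_power_le[of "[:1, 1 :: 'k:]" j] by simp
  then have "vec ([:1, 1:] ^ j) = (\<Sum>i\<le>j. smul (of_nat (j choose i)) (\<xi> i))"
    by (simp add: vec_altdef coeff_linear_poly_power)
  also have "\<dots> = \<xi> j + K (\<xi> j)" by (simp add: K_\<xi> lessThan_Suc_atMost[symmetric] add.commute)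
  finally show ?thesis by (simp add: T_def)
qed

lemma T_vec: "T (vec q) = vec (pcompose q [:1, 1:])"
proof -
  have "pcompose q [:1, 1:] = (\<Sum>i\<le>degree q. smult (coeff q i) ([:1, 1:] ^ i))"
    by (subst (1) poly_as_sum_of_monoms[of q, symmetric]) (simp add: pcompose_sum pcompose_monom)
  then have "vec (pcompose q [:1, 1:]) = (\<Sum>i\<le>degree q. smul (coeff q i) (vec ([:1, 1:] ^ i)))"
    by (simp add: vec_sum vec_smult)
  then show ?thesis by (simp add: vec_def[of q] T.sum T.scale T_\<xi>)
qed

lemma T_funpow_vec: "(T ^^ m) (vec q) = vec (pcompose q [:of_nat m, 1:])"
proof (induction m)
  case (Suc m)
  have "pcompose [:of_nat m, 1:] [:1, 1:] = [:of_nat (Suc m), 1 :: 'k:]"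
    by (simp add: pcompose_pCons)
  then show ?case using Suc by (simp add: T_vec flip: pcompose_assoc)
qed simp

lemma vec_tendsto:
  assumes deg: "\<And>m. degree (q m) \<le> d" "degree r \<le> d"
    and lim: "\<And>i. (\<lambda>m. coeff (q m) i) \<longlonglongrightarrow> coeff r i"
  shows "(\<lambda>m. vec (q m)) \<longlonglongrightarrow> vec r"
  unfolding LIMSEQ_p_iff
proof
  fix k
  have "(\<lambda>m. \<Sum>i\<le>d. norm (coeff (q m) i - coeff r i) * p k (\<xi> i))
      \<longlonglongrightarrow> (\<Sum>i\<le>d. norm (coeff r i - coeff r i) * p k (\<xi> i))"
    by (intro tendsto_intros lim)
  then have l: "(\<lambda>m. \<Sum>i\<le>d. norm (coeff (q m) i - coeff r i) * p k (\<xi> i)) \<longlonglongrightarrow> 0" by simp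
  have "p k (vec (q m) - vec r) \<le> (\<Sum>i\<le>d. norm (coeff (q m) i - coeff r i) * p k (\<xi> i))" for m
  proof -
    have "vec (q m) - vec r = (\<Sum>i\<le>d. smul (coeff (q m) i - coeff r i) (\<xi> i))"
      using deg by (simp add: vec_altdef scale_left_diff_distrib sum_subtractf)
    then show ?thesis using p_sum[of k "\<lambda>i. smul (coeff (q m) i - coeff r i) (\<xi> i)" "{..d}"]
      by (simp add: p_scale)
  qed
  then show "(\<lambda>m. p k (vec (q m) - vec r)) \<longlonglongrightarrow> 0"
    by (intro tendsto_sandwich[OF _ _ tendsto_const l]) (auto intro!: always_eventually)
qed

lemma vec_near_monom_tendsto:
  assumes "s \<longlonglongrightarrow> 0"
  shows "(\<lambda>m. vec (near_monom j (s m))) \<longlonglongrightarrow> \<xi> j"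
proof -
  have deg: "degree (near_monom j t) \<le> j + Suc j" for t :: 'k
    unfolding near_monom_def
    by (intro order_trans[OF degree_mult_le] add_mono degree_monom_le degree_linear_power_le)
  have "(\<lambda>m. vec (near_monom j (s m))) \<longlonglongrightarrow> vec (near_monom j 0)"
  proof (rule vec_tendsto[OF deg deg])
    show "(\<lambda>m. coeff (near_monom j (s m)) i) \<longlonglongrightarrow> coeff (near_monom j 0) i" for i
      using coeff_linear_power_tendsto[OF assms, of 1 "Suc j" "i - j"]
      unfolding near_monom_def coeff_monom_mult by (cases "i < j") simp_all
  qed
  then show ?thesis by (simp add: near_monom_def vec_monom flip: one_pCons)
qed

lemma vec_near_zero_tendsto:
  assumes s: "s \<longlonglongrightarrow> 0"
  shows "(\<lambda>m. vec (near_zero j (s m))) \<longlonglongrightarrow> 0"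
proof -
  have "(\<lambda>m. vec (near_zero j (s m))) \<longlonglongrightarrow> vec 0"
  proof (rule vec_tendsto)
    show "degree (near_zero j t) \<le> Suc j + j" for t :: 'k
      unfolding near_zero_def
      by (intro order_trans[OF degree_smult_le] order_trans[OF degree_mult_le] add_mono
          degree_monom_le degree_linear_power_le)
    show "(\<lambda>m. coeff (near_zero j (s m)) i) \<longlonglongrightarrow> coeff 0 i" for i
      using tendsto_mult[OF s coeff_linear_power_tendsto[OF s, of "- 1" j "i - Suc j"]]
      unfolding near_zero_def coeff_smult coeff_monom_mult by (cases "i < Suc j") simp_all
  qed simp
  then show ?thesis by simp
qed

definition reaches :: "'a \<Rightarrow> 'a \<Rightarrow> bool" where
  "reaches y z \<longleftrightarrow> (\<exists>v. v \<longlonglongrightarrow> y \<and> (\<lambda>m. (T ^^ Suc m) (v m)) \<longlonglongrightarrow> z)"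

lemma linear_funpow: "Vector_Spaces.linear smul smul (T ^^ m)"
  by (induction m) (auto simp: id_def o_def intro: linear_ident linear_compI[OF T.linear_axioms])

lemma reaches_add:
  assumes "reaches y z" "reaches y' z'"
  shows "reaches (y + y') (z + z')"
proof -
  obtain v v' where v: "v \<longlonglongrightarrow> y" "(\<lambda>m. (T ^^ Suc m) (v m)) \<longlonglongrightarrow> z"
    "v' \<longlonglongrightarrow> y'" "(\<lambda>m. (T ^^ Suc m) (v' m)) \<longlonglongrightarrow> z'"
    using assms unfolding reaches_def by blast
  have "(T ^^ m) (x + x') = (T ^^ m) x + (T ^^ m) x'" for m x x'
    using linear_funpow by (simp add: Vector_Spaces.linear_iff)
  then show ?thesis unfolding reaches_def
    using LIMSEQ_p_add[OF v(1,3)] LIMSEQ_p_add[OF v(2,4)]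
    by (intro exI[of _ "\<lambda>m. v m + v' m"]) (simp del: funpow.simps)
qed

lemma reaches_scale:
  assumes "reaches y z"
  shows "reaches (smul c y) (smul c z)"
proof -
  obtain v where v: "v \<longlonglongrightarrow> y" "(\<lambda>m. (T ^^ Suc m) (v m)) \<longlonglongrightarrow> z"
    using assms unfolding reaches_def by blast
  have "(T ^^ m) (smul c x) = smul c ((T ^^ m) x)" for m x
    using linear_funpow by (simp add: Vector_Spaces.linear_iff)
  then show ?thesis unfolding reaches_def
    using LIMSEQ_p_scale[OF v(1)] LIMSEQ_p_scale[OF v(2)]
    by (intro exI[of _ "\<lambda>m. smul c (v m)"]) (simp del: funpow.simps)
qed

lemma reaches_\<xi>: "reaches (\<xi> j) 0" "reaches 0 (\<xi> j)"
proof -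
  define s where "s = (\<lambda>m. inverse (of_nat (Suc m)) :: 'k)"
  have s: "s \<longlonglongrightarrow> 0" unfolding s_def by (rule LIMSEQ_Suc) (rule lim_inverse_n)
  have s': "(\<lambda>m. - s m) \<longlonglongrightarrow> 0" using tendsto_minus[OF s] by simp
  have st: "s m * of_nat (Suc m) = 1" for m
    unfolding s_def by (rule left_inverse) (rule of_nat_neq_0)
  have "(T ^^ Suc m) (vec (near_monom j (- s m))) = vec (near_zero j (- s m))" for m
    unfolding T_funpow_vec using st by (subst translate_near_monom) simp_all
  then show "reaches (\<xi> j) 0"
    unfolding reaches_def using vec_near_monom_tendsto[OF s'] vec_near_zero_tendsto[OF s']
    by (intro exI[of _ "\<lambda>m. vec (near_monom j (- s m))"]) (simp del: funpow.simps)
  have "(T ^^ Suc m) (vec (near_zero j (s m))) = vec (near_monom j (s m))" for m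
    unfolding T_funpow_vec using st by (subst translate_near_zero) simp_all
  then show "reaches 0 (\<xi> j)"
    unfolding reaches_def using vec_near_monom_tendsto[OF s] vec_near_zero_tendsto[OF s]
    by (intro exI[of _ "\<lambda>m. vec (near_zero j (s m))"]) (simp del: funpow.simps)
qed

lemma reaches_span:
  assumes "y \<in> span (range \<xi>)" "z \<in> span (range \<xi>)"
  shows "reaches y z"
proof -
  have 00: "reaches 0 0" using reaches_scale[OF reaches_\<xi>(1)[of 0], of 0] by simp
  have "reaches y 0" using assms(1)
  proof (induction rule: span_induct_alt)
    case (step c x y)
    then show ?case using reaches_add[OF reaches_scale[of x 0 c], of y 0] reaches_\<xi>(1) by auto
  qed (rule 00)
  moreover have "reaches 0 z" using assms(2)
  proof (induction rule: span_induct_alt)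
    case (step c x y)
    then show ?case using reaches_add[OF reaches_scale[of 0 x c], of 0 y] reaches_\<xi>(2) by auto
  qed (rule 00)
  ultimately show ?thesis using reaches_add[of y 0 0 z] by simp
qed

lemma transitive:
  assumes "e > 0" "d > 0"
  obtains v m where "p n (v - y) < e" "p k ((T ^^ m) v - z) < d"
proof -
  obtain y' where y': "y' \<in> span (range \<xi>)" "p n (y' - y) < e / 2"
    using dense_p_approx[OF dense_\<xi>, of "e / 2"] assms by auto
  obtain z' where z': "z' \<in> span (range \<xi>)" "p k (z' - z) < d / 2"
    using dense_p_approx[OF dense_\<xi>, of "d / 2"] assms by auto
  obtain v where v: "v \<longlonglongrightarrow> y'" "(\<lambda>m. (T ^^ Suc m) (v m)) \<longlonglongrightarrow> z'"
    using reaches_span[OF y'(1) z'(1)] unfolding reaches_def by blast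
  have "\<forall>\<^sub>F m in sequentially. p n (v m - y') < e / 2"
    using v(1) assms unfolding LIMSEQ_p_iff by (intro order_tendstoD(2)[of _ 0]) auto
  moreover have "\<forall>\<^sub>F m in sequentially. p k ((T ^^ Suc m) (v m) - z') < d / 2"
    using v(2) assms unfolding LIMSEQ_p_iff by (intro order_tendstoD(2)[of _ 0]) auto
  ultimately have "\<forall>\<^sub>F m in sequentially. p n (v m - y') < e / 2 \<and> p k ((T ^^ Suc m) (v m) - z') < d / 2"
    by (rule eventually_conj)
  then obtain m where m: "p n (v m - y') < e / 2" "p k ((T ^^ Suc m) (v m) - z') < d / 2"
    using eventually_happens'[OF sequentially_bot] by blast
  show thesis
  proof (rule that)
    show "p n (v m - y) < e" using m(1) y'(2) p_triangle[of n "v m" y y'] by linarith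
    show "p k ((T ^^ Suc m) (v m) - z) < d"
      using m(2) z'(2) p_triangle[of k "(T ^^ Suc m) (v m)" z z'] by linarith
  qed
qed

lemma hypercyclic_vector_near:
  fixes D :: "'a set"
  assumes D: "countable D" "closure D = UNIV" and e: "e > 0"
  obtains x where "p n (x - y) < e" "closure (orb x T) = UNIV"
proof -
  have "D \<noteq> {}" using D by auto
  define d where "d = from_nat_into D"
  have d: "range d = D" using D \<open>D \<noteq> {}\<close> by (simp add: d_def range_from_nat_into)
  define U where "U = (\<lambda>i. case prod_decode i of (j, k) \<Rightarrow>
    (\<Union>m. (T ^^ m) -` {x. p k (x - d j) < 1 / Suc k}))"
  have Tm: "continuous_on UNIV (T ^^ m)" for m
    by (induction m) (auto simp: id_def intro: continuous_on_compose2[OF T_continuous] simp: o_def)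
  obtain x where x: "\<And>i. x \<in> U i" "p n (x - y) < e"
  proof (rule Baire_p[of U e n y])
    have "open ((T ^^ m) -` V)" if "open V" for m V
      using Tm[of m] that by (simp add: continuous_on_open_vimage[OF open_UNIV])
    then have "open (\<Union>m. (T ^^ m) -` {x. p k (x - d j) < 1 / Suc k})" for j k
      by (intro open_UN ballI) (simp add: open_p_ball del: vimage_Collect_eq)
    then show "open (U i)" for i unfolding U_def by (cases "prod_decode i") (simp only: prod.case)
    show "closure (U i) = UNIV" for i
      unfolding dense_p_iff
    proof (intro allI impI)
      fix z l and \<epsilon> :: real assume "\<epsilon> > 0"
      obtain j k where jk: "prod_decode i = (j, k)" by (cases "prod_decode i")
      obtain v m where "p l (v - z) < \<epsilon>" "p k ((T ^^ m) v - d j) < 1 / Suc k"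
        using transitive[OF \<open>\<epsilon> > 0\<close>, of "1 / Suc k" l z k "d j"] by auto
      then show "\<exists>v\<in>U i. p l (v - z) < \<epsilon>" by (auto simp: U_def jk)
    qed
  qed (use e in auto)
  have "closure (orb x T) = UNIV"
    unfolding dense_p_iff
  proof (intro allI impI)
    fix z l and \<epsilon> :: real assume \<epsilon>: "\<epsilon> > 0"
    obtain N where N: "1 / Suc N < \<epsilon> / 2" using nat_approx_posE[of "\<epsilon> / 2"] \<epsilon> by auto
    define k where "k = max l N"
    obtain j where j: "p k (d j - z) < \<epsilon> / 2"
      using dense_p_approx[OF D(2), of "\<epsilon> / 2" k z] \<epsilon> d by auto
    obtain m where m: "p k ((T ^^ m) x - d j) < 1 / Suc k"
      using x(1)[of "prod_encode (j, k)"] by (auto simp: U_def)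
    have "1 / Suc k \<le> 1 / Suc N" by (simp add: k_def frac_le)
    then have "p k ((T ^^ m) x - z) < \<epsilon>"
      using m j N p_triangle[of k "(T ^^ m) x" z "d j"] by linarith
    then have "p l ((T ^^ m) x - z) < \<epsilon>" using p_mono[of l k "(T ^^ m) x - z"] by (simp add: k_def)
    then show "\<exists>v\<in>orb x T. p l (v - z) < \<epsilon>" by (auto simp: orb_def)
  qed
  with x(2) show thesis by (rule that)
qed

lemma K_range: "K ` span (range \<xi>) = span (range \<xi>)"
proof
  have "K (\<xi> j) \<in> span (range \<xi>)" for j
    unfolding K_\<xi> by (intro span_sum span_scale span_base) simp
  then show "K ` span (range \<xi>) \<subseteq> span (range \<xi>)"
    unfolding K.span_image[symmetric] by (intro span_minimal subspace_span) auto
  have "\<xi> j \<in> K ` span (range \<xi>)" for j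
  proof (induction j rule: less_induct)
    case (less j)
    have sub: "subspace (K ` span (range \<xi>))" by (intro K.subspace_image subspace_span)
    have "K (\<xi> (Suc j)) - (\<Sum>i<j. smul (of_nat (Suc j choose i)) (\<xi> i)) \<in> K ` span (range \<xi>)"
      using less sub by (intro subspace_diff subspace_sum subspace_scale imageI span_base) auto
    also have "K (\<xi> (Suc j)) - (\<Sum>i<j. smul (of_nat (Suc j choose i)) (\<xi> i)) = smul (of_nat (Suc j)) (\<xi> j)"
      by (simp add: K_\<xi>)
    finally have "smul (inverse (of_nat (Suc j))) (smul (of_nat (Suc j)) (\<xi> j)) \<in> K ` span (range \<xi>)"
      by (rule subspace_scale[OF sub])
    moreover have "smul (inverse (of_nat (Suc j))) (smul (of_nat (Suc j)) (\<xi> j)) = \<xi> j"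
      by (simp del: of_nat_Suc)
    ultimately show ?case by (simp only:)
  qed
  then show "span (range \<xi>) \<subseteq> K ` span (range \<xi>)"
    by (intro span_minimal K.subspace_image subspace_span) auto
qed

lemma K_locally_nilpotent:
  assumes "y \<in> span (range \<xi>)"
  obtains n where "(K ^^ n) y = 0"
proof -
  have lin: "Vector_Spaces.linear smul smul (K ^^ n)" for n
    by (induction n) (auto simp: id_def o_def intro: linear_ident linear_compI[OF K.linear_axioms])
  have \<xi>0: "(K ^^ n) (\<xi> i) = 0" if "i < n" for n i
    using that
  proof (induction n arbitrary: i)
    case (Suc n)
    interpret Kn: Vector_Spaces.linear smul smul "K ^^ n" by (rule lin)
    have "(K ^^ Suc n) (\<xi> i) = (\<Sum>l<i. smul (of_nat (i choose l)) ((K ^^ n) (\<xi> l)))"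
      by (simp only: funpow_Suc_right o_apply K_\<xi> Kn.sum Kn.scale)
    also have "\<dots> = 0" using Suc by (intro sum.neutral) auto
    finally show ?case .
  qed simp
  obtain q where q: "y = vec q" using assms range_vec by blast
  define n where "n = Suc (degree q)"
  interpret Kn: Vector_Spaces.linear smul smul "K ^^ n" by (rule lin)
  have "(K ^^ n) (\<xi> i) = 0" if "i \<le> degree q" for i using that by (intro \<xi>0) (simp add: n_def)
  then have "(K ^^ n) y = 0" unfolding q vec_def Kn.sum Kn.scale by (intro sum.neutral) auto
  then show thesis by (rule that)
qed

text \<open>The polynomials in \<^term>\<open>K\<close>, generated by Horner's scheme.\<close>

inductive polyop :: "('a \<Rightarrow> 'a) \<Rightarrow> bool" where
  zero: "polyop (\<lambda>x. 0)"
| horner: "polyop Q \<Longrightarrow> polyop (\<lambda>x. smul c x + K (Q x))"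

lemma polyop_linear: "polyop Q \<Longrightarrow> Vector_Spaces.linear smul smul Q"
proof (induction rule: polyop.induct)
  case (horner Q c)
  show ?case
    by (rule linear_addI[OF linear_scaleI[OF linear_ident] linear_compI[OF K.linear_axioms horner.IH]])
qed (rule linear_zeroI)

lemma polyop_commute: "polyop Q \<Longrightarrow> Q (K x) = K (Q x)"
  by (induction rule: polyop.induct) (simp_all add: K.add K.scale)

lemma polyop_commute_T:
  assumes "polyop Q"
  shows "Q ((T ^^ n) x) = (T ^^ n) (Q x)"
proof -
  interpret Q: Vector_Spaces.linear smul smul Q using assms by (rule polyop_linear)
  show ?thesis by (induction n) (simp_all add: T_def Q.add polyop_commute[OF assms])
qed

lemma polyop_continuous:
  assumes "polyop Q"
  shows "continuous_on UNIV Q"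
proof (rule continuous_if_p_bounded[OF polyop_linear[OF assms]])
  show "\<exists>j C. \<forall>x. p k (Q x) \<le> C * p j x" for k
    using assms
  proof (induction arbitrary: k rule: polyop.induct)
    case (horner Q c)
    obtain C where C: "C \<ge> 0" "\<And>x. p k (K x) \<le> C * p 0 x" using p0_operator_bound K by blast
    obtain j D where D: "\<And>x. p 0 (Q x) \<le> D * p j x" using horner.IH by blast
    have "p k (smul c x + K (Q x)) \<le> (norm c + C * \<bar>D\<bar>) * p (max k j) x" for x
    proof -
      have "p 0 (Q x) \<le> \<bar>D\<bar> * p (max k j) x"
        using D[of x] mult_mono[OF abs_ge_self[of D] p_mono[of j "max k j" x]] by simp
      then have "p k (K (Q x)) \<le> C * (\<bar>D\<bar> * p (max k j) x)"
        using C(2)[of "Q x"] mult_left_mono[OF _ C(1)] order_trans by blast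
      moreover have "p k (smul c x) \<le> norm c * p (max k j) x"
        unfolding p_scale by (intro mult_left_mono p_mono) auto
      ultimately show ?thesis using p_add[of k "smul c x" "K (Q x)"] by (simp add: algebra_simps)
    qed
    then show ?case by blast
  next
    case zero
    show ?case by (intro exI[of _ 0]) simp
  qed
qed

lemma polyop_span:
  assumes "polyop Q" "x \<in> span (range \<xi>)"
  shows "Q x \<in> span (range \<xi>)"
  using assms K_range by (induction rule: polyop.induct) (auto intro: span_add span_scale span_zero)

lemma scale_plus_nilpotent_surj:
  assumes Q: "polyop Q" and c: "c \<noteq> 0" and y: "y \<in> span (range \<xi>)" "(K ^^ n) y = 0"
  shows "\<exists>z\<in>span (range \<xi>). smul c z + K (Q z) = y"
  using y
proof (induction n arbitrary: y)
  case 0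
  interpret Q: Vector_Spaces.linear smul smul Q using Q by (rule polyop_linear)
  show ?case using 0 by (intro bexI[of _ 0]) (auto intro: span_zero)
next
  case (Suc n)
  interpret Q: Vector_Spaces.linear smul smul Q using Q by (rule polyop_linear)
  define w where "w = smul (inverse c) y"
  have w: "w \<in> span (range \<xi>)" "smul c w = y" using Suc.prems c by (auto simp: w_def intro: span_scale)
  have Kn: "(K ^^ m) (Q x) = Q ((K ^^ m) x)" for m x
    by (induction m) (simp_all add: polyop_commute[OF Q])
  have Kn': "(K ^^ m) (smul a x) = smul a ((K ^^ m) x)" for m a x
    by (induction m) (simp_all add: K.scale)
  have "(K ^^ n) (K (Q w)) = Q ((K ^^ Suc n) w)"
    by (simp only: polyop_commute[OF Q, symmetric] Kn funpow_Suc_right o_apply)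
  also have "\<dots> = 0" unfolding w_def Kn' Suc.prems(2) by simp
  finally have "(K ^^ n) (K (Q w)) = 0" .
  moreover have "K (Q w) \<in> span (range \<xi>)" using polyop_span[OF Q w(1)] K_range by blast
  ultimately obtain z where z: "z \<in> span (range \<xi>)" "smul c z + K (Q z) = K (Q w)"
    using Suc.IH by blast
  show ?case
  proof (intro bexI)
    show "w - z \<in> span (range \<xi>)" using w z by (intro span_diff)
    show "smul c (w - z) + K (Q (w - z)) = y"
      unfolding scale_right_diff_distrib Q.diff K.diff w(2) z(2)[symmetric] by simp
  qed
qed

lemma polyop_surj:
  assumes "polyop Q"
  shows "(\<forall>x. Q x = 0) \<or> Q ` span (range \<xi>) = span (range \<xi>)"
  using assms
proof (induction rule: polyop.induct)
  case (horner Q c)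
  show ?case
  proof (cases "c = 0")
    case True
    from horner.IH show ?thesis
    proof
      assume "Q ` span (range \<xi>) = span (range \<xi>)"
      then have "(\<lambda>x. K (Q x)) ` span (range \<xi>) = span (range \<xi>)"
        using K_range by (simp flip: image_image)
      then show ?thesis using True by simp
    qed (simp add: True)
  next
    case False
    have "y \<in> (\<lambda>x. smul c x + K (Q x)) ` span (range \<xi>)" if y: "y \<in> span (range \<xi>)" for y
    proof -
      obtain n where "(K ^^ n) y = 0" using K_locally_nilpotent[OF y] by blast
      then show ?thesis using scale_plus_nilpotent_surj[OF horner.hyps False y] by (auto simp: image_iff)
    qed
    then show ?thesis
      using polyop_span[OF polyop.horner[OF horner.hyps]] by blast
  qed
qed simp

lemma polyop_add: "polyop Q \<Longrightarrow> polyop R \<Longrightarrow> polyop (\<lambda>x. Q x + R x)"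
proof (induction arbitrary: R rule: polyop.induct)
  case (horner Q c)
  from \<open>polyop R\<close> show ?case
  proof cases
    case zero
    then show ?thesis using polyop.horner[OF horner.hyps] by simp
  next
    case R: (horner S d)
    have "polyop (\<lambda>x. smul (c + d) x + K (Q x + S x))"
      using horner.IH[OF R(2)] by (rule polyop.horner)
    moreover have "(\<lambda>x. smul (c + d) x + K (Q x + S x)) = (\<lambda>x. smul c x + K (Q x) + R x)"
      by (auto simp: R(1) K.add scale_left_distrib)
    ultimately show ?thesis by simp
  qed
qed simp

lemma polyop_scale: "polyop Q \<Longrightarrow> polyop (\<lambda>x. smul a (Q x))"
proof (induction rule: polyop.induct)
  case (horner Q c)
  have "(\<lambda>x. smul a (smul c x + K (Q x))) = (\<lambda>x. smul (a * c) x + K (smul a (Q x)))"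
    by (auto simp: K.scale scale_right_distrib)
  then show ?case using polyop.horner[OF horner.IH] by simp
qed (simp add: polyop.zero)

lemma orb_span_polyop:
  assumes "w \<in> span (orb x T)"
  obtains Q where "polyop Q" "w = Q x"
proof -
  have "polyop (T ^^ n)" for n
  proof (induction n)
    case 0
    have "(\<lambda>x. smul 1 x + K 0) = id" by auto
    then show ?case using polyop.horner[OF polyop.zero, of 1] by simp
  next
    case (Suc n)
    have "polyop (\<lambda>x. smul 0 x + K ((T ^^ n) x))" using Suc by (rule polyop.horner)
    from polyop_add[OF Suc this] have "polyop (\<lambda>x. (T ^^ n) x + K ((T ^^ n) x))" by simp
    moreover have "T ^^ Suc n = (\<lambda>x. (T ^^ n) x + K ((T ^^ n) x))"
      by (rule ext, unfold funpow.simps o_apply, rule T_def)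
    ultimately show ?case by (simp only:)
  qed
  define V where "V = (\<lambda>Q. Q x) ` Collect polyop"
  have V: "Q x \<in> V" if "polyop Q" for Q using that by (simp add: V_def)
  have "orb x T \<subseteq> V" using \<open>\<And>n. polyop (T ^^ n)\<close> V by (auto simp: orb_def)
  moreover have "subspace V"
  proof (rule subspaceI)
    show "0 \<in> V" using V[OF polyop.zero] .
    show "u + v \<in> V" if "u \<in> V" "v \<in> V" for u v
      using that V[OF polyop_add] by (auto simp: V_def)
    show "smul c u \<in> V" if "u \<in> V" for c u
      using that V[OF polyop_scale] by (auto simp: V_def)
  qed
  ultimately have "w \<in> V" using span_minimal assms by blast
  then show thesis using that by (auto simp: V_def)
qed

lemma orb_span_hypercyclic:
  assumes x: "closure (orb x T) = UNIV" and w: "w \<in> span (orb x T)" "w \<noteq> 0"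
  shows "closure (orb w T) = UNIV"
proof -
  obtain Q where Q: "polyop Q" "w = Q x" using w orb_span_polyop by blast
  then have "Q ` span (range \<xi>) = span (range \<xi>)" using polyop_surj w(2) by blast
  then have "span (range \<xi>) \<subseteq> Q ` closure (orb x T)" using x by blast
  also have "\<dots> \<subseteq> closure (Q ` orb x T)"
    using polyop_continuous[OF Q(1)] x
    by (intro image_closure_subset closure_subset closed_closure) auto
  also have "Q ` orb x T = orb w T"
    by (auto simp: orb_def Q(2) polyop_commute_T[OF Q(1)] image_def)
  finally have "closure (span (range \<xi>)) \<subseteq> closure (orb w T)" by (simp add: closure_minimal)
  then show ?thesis using dense_\<xi> by auto
qed

end

section \<open>Conjugation into the given subalgebra\<close>

lemma (in normed_frechet) finite_span_closed:
  assumes "finite B"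
  shows "closure (span B) = span B"
proof -
  have "x \<in> span B" if x: "x \<in> closure (span B)" for x
  proof (rule ccontr)
    assume "x \<notin> span B"
    then obtain f where f: "p0_functional f" "\<And>y. y \<in> span B \<Longrightarrow> f y = 0" "f x \<noteq> 0"
      using separating_functional[OF assms] by blast
    interpret f: Vector_Spaces.linear smul "(*)" f using f by (simp add: p0_functional_def)
    obtain y where y: "y \<in> span B" "p 0 (y - x) < norm (f x)"
      using x f(3) unfolding closure_p_iff by (meson zero_less_norm_iff)
    have "norm (f (y - x)) \<le> p 0 (y - x)" using f(1) by (auto simp: p0_functional_def)
    then show False using y f(2)[OF y(1)] by (simp add: f.diff)
  qed
  then show ?thesis using closure_subset by blast
qed

lemma frechet_topology_shift:
  assumes "frechet_topology smul q"
  shows "frechet_topology smul (\<lambda>n. q (n + m))"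
proof -
  have mono1: "q n x \<le> q (Suc n) x" and nonneg: "0 \<le> q n x" for n x
    using assms by (auto simp: frechet_topology_def seminorm_def)
  have mono: "q n x \<le> q (n + m) x" for n x
    using mono1 by (rule lift_Suc_mono_le) simp
  have op: "open U \<longleftrightarrow> (\<forall>x\<in>U. \<exists>n. \<exists>e>0. {y. q n (y - x) < e} \<subseteq> U)" for U
    using assms unfolding frechet_topology_def by simp
  have complete: "\<exists>l. s \<longlonglongrightarrow> l" if "\<forall>n. \<forall>e>0. \<exists>M. \<forall>i\<ge>M. \<forall>j\<ge>M. q n (s i - s j) < e" for s
    using assms that unfolding frechet_topology_def by (elim conjE) (rule mp, erule spec)
  show ?thesis
    unfolding frechet_topology_def
  proof (intro conjI allI impI)
    show "seminorm smul (q (n + m))" for n using assms by (simp add: frechet_topology_def)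
    show "q (n + m) x \<le> q (Suc n + m) x" for n x using mono1 by simp
    fix x :: 'b assume "x \<noteq> 0"
    moreover have "\<forall>x. x \<noteq> 0 \<longrightarrow> (\<exists>n. q n x \<noteq> 0)" using assms by (simp add: frechet_topology_def)
    ultimately obtain n where "q n x \<noteq> 0" by blast
    then show "\<exists>n. q (n + m) x \<noteq> 0" using mono[of n x] nonneg[of n x] by (intro exI[of _ n]) linarith
  next
    fix U :: "'b set"
    show "open U \<longleftrightarrow> (\<forall>x\<in>U. \<exists>n. \<exists>e>0. {y. q (n + m) (y - x) < e} \<subseteq> U)"
      unfolding op
    proof (intro iffI ballI)
      fix x assume "\<forall>x\<in>U. \<exists>n. \<exists>e>0. {y. q n (y - x) < e} \<subseteq> U" "x \<in> U"
      then obtain n e where ne: "e > 0" "{y. q n (y - x) < e} \<subseteq> U" by blast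
      have "{y. q (n + m) (y - x) < e} \<subseteq> {y. q n (y - x) < e}"
        using mono by (auto intro: le_less_trans)
      then show "\<exists>n. \<exists>e>0. {y. q (n + m) (y - x) < e} \<subseteq> U" using ne by blast
    qed blast
  next
    fix s :: "nat \<Rightarrow> 'b" assume s: "\<forall>n. \<forall>e>0. \<exists>M. \<forall>i\<ge>M. \<forall>j\<ge>M. q (n + m) (s i - s j) < e"
    show "\<exists>l. s \<longlonglongrightarrow> l"
    proof (rule complete, intro allI impI)
      fix n and e :: real assume "e > 0"
      then obtain M where "\<forall>i\<ge>M. \<forall>j\<ge>M. q (n + m) (s i - s j) < e" using s by blast
      then show "\<exists>M. \<forall>i\<ge>M. \<forall>j\<ge>M. q n (s i - s j) < e"
        using mono by (meson le_less_trans)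
    qed
  qed
qed

lemma normed_frechet_exists:
  assumes "frechet_space smul" "admits_continuous_norm smul"
  obtains p where "normed_frechet smul p"
proof -
  interpret frechet_space smul by fact
  obtain q where q: "frechet_topology smul q" using ex_seminorms by blast
  obtain N where N: "seminorm smul N" "\<And>x. N x = 0 \<Longrightarrow> x = 0" "continuous_on UNIV N"
    using assms(2) unfolding admits_continuous_norm_def by blast
  have Nscale: "N (smul c x) = norm c * N x" and N0: "0 \<le> N x" for c x
    using N(1) by (auto simp: seminorm_def)
  have "open (N -` {..<1})" using N(3) by (simp add: continuous_on_open_vimage[OF open_UNIV])
  moreover have "0 \<in> N -` {..<1}" using Nscale[of 0 0] by simp
  moreover have "open U \<longleftrightarrow> (\<forall>x\<in>U. \<exists>n. \<exists>e>0. {y. q n (y - x) < e} \<subseteq> U)" for U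
    using q unfolding frechet_topology_def by simp
  ultimately obtain m e where m: "e > 0" "{y. q m (y - 0) < e} \<subseteq> N -` {..<1}" by metis
  have zero: "x = 0" if "q m x = 0" for x
  proof (rule ccontr)
    assume "x \<noteq> 0"
    then have Nx: "N x > 0" using N(2)[of x] N0[of x] by linarith
    have "q m (smul c x) = norm c * q m x" for c
      using q by (simp add: frechet_topology_def seminorm_def)
    then have "q m (smul (of_real (inverse (N x))) x - 0) < e" using that m(1) by simp
    then have "N (smul (of_real (inverse (N x))) x) < 1" using m(2) by blast
    then show False unfolding Nscale norm_of_real using Nx by simp
  qed
  have "normed_frechet smul (\<lambda>n. q (n + m))"
    by (intro normed_frechet.intro vector_space_axioms normed_frechet_axioms.intro
        frechet_topology_shift q) (use zero in simp)
  then show thesis by (rule that)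
qed

lemma (in normed_frechet) enumerate_dense_basis:
  assumes "countable_dimensional smul A" "closure A = UNIV" "infinite_dimensional smul"
  obtains b :: "nat \<Rightarrow> 'a" where "\<And>n. b n \<notin> span (b ` {..<n})" "span (range b) = A"
proof -
  obtain B where B: "countable B" "\<not> dependent B" "span B = A"
    using assms(1) unfolding countable_dimensional_def by blast
  have "infinite B"
  proof
    assume "finite B"
    then have "span B = UNIV" using finite_span_closed[of B] B(3) assms(2) by simp
    then show False using \<open>finite B\<close> assms(3) unfolding infinite_dimensional_def by blast
  qed
  then have bij: "bij_betw (from_nat_into B) UNIV B" by (rule bij_betw_from_nat_into[OF B(1)])
  show thesis
  proof (rule that[of "from_nat_into B"])
    fix n
    have "from_nat_into B ` {..<n} \<subseteq> B - {from_nat_into B n}"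
      using bij by (auto simp: bij_betw_def dest: injD)
    moreover have "from_nat_into B n \<in> B" using bij by (auto simp: bij_betw_def)
    ultimately show "from_nat_into B n \<notin> span (from_nat_into B ` {..<n})"
      using B(2) span_mono unfolding dependent_def by blast
  next
    show "span (range (from_nat_into B)) = A" using bij B(3) by (simp add: bij_betw_def)
  qed
qed

theorem theorem3p5:
  fixes smul :: "'k::real_or_complex \<Rightarrow> 'a::{ring,topological_space} \<Rightarrow> 'a"
    and A :: "'a set" and a :: 'a
  assumes "frechet_algebra smul"
    and "separable_space (euclidean :: 'a topology)"
    and "infinite_dimensional smul"
    and "admits_continuous_norm smul"
    and "subalgebra smul A"
    and "closure A = UNIV"
    and "countable_dimensional smul A"
    and "a \<in> A - {0}"
  shows "\<exists>T K. continuous_linear smul smul T \<and> nuclear smul K \<and> T = (\<lambda>x. x + K x) \<and>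
           A = module.span smul (orb a T) \<and>
           T ` A \<subseteq> A \<and> hypercyclic_algebra smul T A"
proof -
  obtain p where "normed_frechet smul p"
    using normed_frechet_exists frechet_algebra.axioms(1) assms(1,4) by metis
  then interpret normed_frechet smul p .
  obtain b :: "nat \<Rightarrow> 'a" where b: "\<And>n. b n \<notin> span (b ` {..<n})" and spanb: "span (range b) = A"
    using enumerate_dense_basis[OF assms(7,6,3)] by metis
  obtain \<xi> :: "nat \<Rightarrow> 'a" and K where \<xi>: "span (range \<xi>) = span (range b)" and K: "p0_operator K" "nuclear smul K"
    and K\<xi>: "\<And>j. K (\<xi> j) = (\<Sum>i<j. smul (of_nat (j choose i)) (\<xi> i))"
    by (rule exists_binomial_shift[of b, OF b]) (rule that)
  interpret H: binomial_shift smul p \<xi> K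
    by unfold_locales (use K K\<xi> \<xi> spanb assms(6) in auto)
  obtain D :: "'a set" where D: "countable D" "closure D = UNIV"
    using assms(2) by (auto simp: separable_space_def)
  obtain f where f: "p0_functional f" "f a \<noteq> 0"
    using separating_functional[of "{}" a] assms(8) by auto
  interpret f: Vector_Spaces.linear smul "(*)" f using f by (simp add: p0_functional_def)
  obtain x where x: "p 0 (x - a) < norm (f a) / 8" "closure (orb x H.T) = UNIV"
    using H.hypercyclic_vector_near[OF D, of "norm (f a) / 8" 0 a] f(2) by auto
  have "norm (f (a - x)) \<le> p 0 (a - x)" using f(1) by (auto simp: p0_functional_def)
  then have "norm (f a - f x) < norm (f a) / 8" using x(1) p_commute[of 0 a x] by (simp add: f.diff)
  moreover have "norm (f a) > 0" using f(2) by simp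
  ultimately have fx: "norm (f x) > norm (f a) / 2"
    using norm_triangle_ineq2[of "f a" "f x"] by linarith
  define E where "E = span (orb x H.T)"
  have orb_range: "range (\<lambda>n. (H.T ^^ n) x) = orb x H.T" by (auto simp: orb_def)
  have E_dense: "closure E = UNIV"
    using x(2) closure_mono[OF span_superset, of "orb x H.T"] by (auto simp: E_def)
  have xE: "x \<in> E" unfolding E_def orb_range[symmetric] by (rule span_base, rule range_eqI[of _ _ 0]) simp
  obtain L where L: "p0_operator L" "\<And>z. p 0 (L z) \<le> 1 / 2 * p 0 z" "x + L x = a"
    and LE: "(\<lambda>z. z + L z) ` E = A"
  proof (rule dense_subspace_isomorphism[of "\<lambda>n. (H.T ^^ n) x" b x a f])
    show "p 0 (a - x) \<le> 1 / 4 * norm (f x)" using x(1) fx p_commute[of 0 a x] by linarith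
    show "f x \<noteq> 0" using fx by auto
  qed (use spanb E_dense xE assms(6,8) f(1) in \<open>simp_all add: orb_range E_def\<close>)
  define J where "J = (\<lambda>z. z + L z)"
  have J: "continuous_linear smul smul J" unfolding J_def by (rule continuous_linear_id_plus[OF L(1)])
  interpret J: Vector_Spaces.linear smul smul J using J by (simp add: continuous_linear_def)
  obtain S where S: "continuous_linear smul smul S" "\<And>z. S (z + L z) = z" "\<And>z. S z + L (S z) = z"
    by (rule id_plus_contraction_inverse[OF L(1,2)]) (rule that)
  then have SJ: "S (J z) = z" and JS: "J (S z) = z" for z by (simp_all add: J_def)
  have Jx: "J x = a" and JE: "J ` E = A" using L(3) LE by (simp_all add: J_def)
  define T where "T = (\<lambda>z. J (H.T (S z)))"
  have TJ: "(T ^^ n) (J z) = J ((H.T ^^ n) z)" for n z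
    by (induction n) (simp_all add: T_def SJ)
  have orbJ: "orb (J z) T = J ` orb z H.T" for z by (auto simp: orb_def TJ)
  have T_eq: "T = (\<lambda>z. z + J (K (S z)))"
    by (rule ext) (simp add: T_def H.T_def J.add JS)
  have lin: "Vector_Spaces.linear smul smul S" and cont: "continuous_on UNIV J" "continuous_on UNIV S"
    using J S(1) by (simp_all add: continuous_linear_def)
  have "continuous_on UNIV (\<lambda>z. J (H.T (S z)))"
    by (rule continuous_on_compose2[OF cont(1) continuous_on_compose2[OF H.T_continuous cont(2)]]) auto
  then have "continuous_linear smul smul T"
    unfolding T_def continuous_linear_def
    using linear_compI[OF J.linear_axioms linear_compI[OF H.T.linear_axioms lin]] by blast
  moreover have "nuclear smul (\<lambda>z. J (K (S z)))" by (rule nuclear_compose[OF J K(2) S(1)])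
  moreover have "A = span (orb a T)"
    unfolding Jx[symmetric] orbJ J.span_image using JE by (simp add: E_def)
  moreover have "T ` A \<subseteq> A"
  proof -
    have "H.T ` orb x H.T \<subseteq> orb x H.T"
    proof
      fix z assume "z \<in> H.T ` orb x H.T"
      then obtain n where "z = (H.T ^^ Suc n) x" by (auto simp: orb_def)
      then show "z \<in> orb x H.T" unfolding orb_def by blast
    qed
    then have "H.T ` E \<subseteq> E" unfolding E_def H.T.span_image[symmetric] by (rule span_mono)
    then show ?thesis unfolding JE[symmetric] by (auto simp: T_def SJ)
  qed
  moreover have "A - {0} \<subseteq> HC T"
  proof
    fix w assume "w \<in> A - {0}"
    then obtain z where z: "z \<in> E" "w = J z" "z \<noteq> 0" using JE by force
    then have "closure (orb z H.T) = UNIV" using H.orb_span_hypercyclic[OF x(2)] by (simp add: E_def)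
    then have "J ` UNIV \<subseteq> closure (J ` orb z H.T)"
      using image_closure_subset[of "orb z H.T" J, OF _ closed_closure closure_subset] cont(1) by simp
    moreover have "J ` UNIV = UNIV" using JS by (metis surj_def)
    ultimately show "w \<in> HC T" using z(2) by (simp add: HC_def orbJ top.extremum_unique)
  qed
  ultimately show ?thesis
    using assms(5,8) T_eq unfolding hypercyclic_algebra_def by blast
qed

end
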